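(* For every word $w\in\mathbf W$, $w$ is $\mathfrak{gl}_{\mathcal N}$-equivalent to its quasi $P$-tableau $P(w)$, that is $w\simeq P(w)$. In particular, each connected component of the $\mathfrak{gl}_{\mathcal N}$-crystal $\mathbf W$ is isomorphic to $\mathbf B(\alpha)$ for some composition $\alpha$.
   Context: $\mathcal N=\frac12\mathbb Z_{>0}$ with its usual linear order; elements of $\mathbb Z_{>0}$ are even, elements of $\frac12+\mathbb Z_{\ge0}$ are odd. $I=\frac12\mathbb Z_{>0}$. $P=\bigoplus_{b\in\mathcal N}\mathbb Z\epsilon_b$ with $(\epsilon_a,\epsilon_b)=(-1)^{|a|}\delta_{ab}$ ($|a|$ the parity). Simple roots: $\alpha_i=\epsilon_i-\epsilon_{i+\frac12}$, $i\in I$. A $\mathfrak{gl}_{\mathcal N}$-crystal is a set $B$ with maps $\mathrm{wt}:B\to P$, $\varepsilon_i,\varphi_i:B\to\mathbb Z_{\ge0}$, $e_i,f_i:B\to B\cup\{\mathbf 0\}$ ($i\in I$; $\mathbf 0$ a formal symbol) such that: (1) $\varphi_i(b)+\varepsilon_i(b)$ is $1$ if $(\mathrm{wt}(b),\alpha_i)\ne0$ and $0$ otherwise; (2) if $e_ib\in B$ then $\varepsilon_i(e_ib)=\varepsilon_i(b)-1$, $\varphi_i(e_ib)=\varphi_i(b)+1$, $\mathrm{wt}(e_ib)=\mathrm{wt}(b)+\alpha_i$; (3) if $f_ib\in B$ then $\varepsilon_i(f_ib)=\varepsilon_i(b)+1$, $\varphi_i(f_ib)=\varphi_i(b)-1$,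 $\mathrm{wt}(f_ib)=\mathrm{wt}(b)-\alpha_i$; (4) $f_ib=b'$ iff $b=e_ib'$. It is viewed as an $I$-colored oriented graph ($b\xrightarrow{i}b'$ iff $b'=f_ib$). An isomorphism of crystals is an isomorphism of colored oriented graphs preserving $\mathrm{wt},\varepsilon_i,\varphi_i$. $C(b)$ is the connected component of $b$. $b_1\simeq b_2$ ($\mathfrak{gl}_{\mathcal N}$-equivalence) means there is a crystal isomorphism $C(b_1)\to C(b_2)$ sending $b_1$ to $b_2$. Crystal of words: $\mathbf W$ is the set of finite words in $\mathcal N$ (including the empty word), $\mathrm{wt}(w_1\cdots w_r)=\sum_k\epsilon_{w_k}$. On letters, $f_i(i)=i+\frac12$, $e_i(i+\frac12)=i$, all other $e_i,f_i$ give $\mathbf 0$. On $w=w_1\cdots w_r$: for $i\in\mathbb Z_{>0}$ (resp. $i\in\frac12+\mathbb Z_{\ge0}$) let $k$ be the smallest (resp. largest) index with $w_k\in\{i,i+\frac12\}$; $e_iw$, $f_iw$ are obtained by applying $e_i$, $f_i$ to $w_k$ ($\mathbf 0$ if that gives $\mathbf 0$); if no such $k$ exists, $e_iw=f_iw=\mathbf 0$. $\varepsilon_i(w)=1$ if $e_iw\neq\mathbf 0$, else $0$; $\varphi_i(w)=1$ if $f_iw\ne\mathbf 0$, else $0$. A composition $\alpha=(\alpha_1,\dots,\alpha_t)$ (finite sequence of positive integers, the empty one allowed) is identified with its ribbon diagram: rows from top to bottom have $\alpha_1,\dots,\alpha_t$ nodes, and the leftmost node of row $i+1$ is directly below the rightmost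 node of row $i$. A quasi-ribbon tableau of shape $\alpha$ is a filling with entries in $\mathcal N$ weakly increasing along rows (left to right) and columns (top to bottom), with integers strictly increasing in each column and odd half-integers strictly increasing in each row; $\mathbf B(\alpha)$ is the set of these. $w(T)$ is the word obtained by reading rows from top to bottom, each row right to left; $\mathbf B(\alpha)$ is a $\mathfrak{gl}_{\mathcal N}$-crystal by identifying $T$ with $w(T)\in\mathbf W$. Insertion: let $t_1,t_2,\dots$ be the entries of a quasi-ribbon tableau $T$ from northwest to southeast. For $b\in\mathcal N$, let $k$ be the smallest index with $b\le t_k$ if $b\in\mathbb Z_{>0}$, resp. $b<t_k$ if $b\in\frac12+\mathbb Z_{\ge0}$ (if none, $k-1$ is the number of nodes of $T$). Then $b\to T$ is the quasi-ribbon tableau obtained by gluing the sub-tableau of the first $k-1$ nodes, the node $b$, and the sub-tableau of the remaining nodes, $b$ being directly below the last node of the former and directly left of the first node of the latter. For $w=w_1\cdots w_r$, $P(w)=w_r\to(\cdots\to(w_2\to w_1))$; $P$ of the empty word is the empty tableau. *)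

theory Defs
  imports Complex_Main "HOL-Library.Poly_Mapping"
begin

section \<open>The index set of positive half-integers\<close>

text \<open>
  One type serves both as the alphabet and as the index set of the simple roots, since both
  are the set of positive half-integers.
\<close>

typedef half = "{x :: rat. \<exists>n :: nat. n > 0 \<and> x = of_nat n / 2}"
  morphisms rat_of_half half_of_rat
  by (rule exI[of _ "1 / 2"]) (auto intro: exI[of _ "1 :: nat"])

instantiation half :: linorder
begin

definition less_eq_half :: "half \<Rightarrow> half \<Rightarrow> bool" where
  "less_eq_half a b \<longleftrightarrow> rat_of_half a \<le> rat_of_half b"

definition less_half :: "half \<Rightarrow> half \<Rightarrow> bool" where
  "less_half a b \<longleftrightarrow> rat_of_half a < rat_of_half b"

instance
  by standard (auto simp: less_eq_half_def less_half_def rat_of_half_inject)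

end

text \<open>Integers are the even letters; the other half-integers are the odd ones.\<close>

definition is_integer :: "half \<Rightarrow> bool" where
  "is_integer a \<longleftrightarrow> rat_of_half a \<in> \<int>"

definition parity :: "half \<Rightarrow> nat" where
  "parity a = (if is_integer a then 0 else 1)"

definition plus_half :: "half \<Rightarrow> half" where
  "plus_half a = half_of_rat (rat_of_half a + 1 / 2)"

lemma rat_of_half_plus_half: "rat_of_half (plus_half a) = rat_of_half a + 1 / 2"
proof -
  obtain n :: nat where n: "rat_of_half a = of_nat n / 2"
    using rat_of_half[of a] by blast
  have "rat_of_half a + 1 / 2 = of_nat (Suc n) / 2"
    by (simp add: n field_simps)
  then have "rat_of_half a + 1 / 2 \<in> {x :: rat. \<exists>n :: nat. n > 0 \<and> x = of_nat n / 2}"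
    by blast
  then show ?thesis
    by (simp add: plus_half_def half_of_rat_inverse)
qed


section \<open>Crystals\<close>

type_synonym weight = "half \<Rightarrow>\<^sub>0 int"

definition basis_weight :: "half \<Rightarrow> weight" where
  "basis_weight a = Poly_Mapping.single a 1"

definition weight_form :: "weight \<Rightarrow> weight \<Rightarrow> int" where
  "weight_form x y =
     (\<Sum>a \<in> Poly_Mapping.keys x. (- 1) ^ parity a * Poly_Mapping.lookup x a * Poly_Mapping.lookup y a)"

definition simple_root :: "half \<Rightarrow> weight" where
  "simple_root i = basis_weight i - basis_weight (plus_half i)"

text \<open>\<open>None\<close> plays the role of the formal symbol \<open>\<zero>\<close>.\<close>

record 'b crystal =
  verts :: "'b set"
  wt :: "'b \<Rightarrow> weight"
  eps :: "half \<Rightarrow> 'b \<Rightarrow> nat"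
  phi :: "half \<Rightarrow> 'b \<Rightarrow> nat"
  e_op :: "half \<Rightarrow> 'b \<Rightarrow> 'b option"
  f_op :: "half \<Rightarrow> 'b \<Rightarrow> 'b option"

definition gl_crystal :: "'b crystal \<Rightarrow> bool" where
  "gl_crystal B \<longleftrightarrow>
     (\<forall>i. \<forall>b \<in> verts B. \<forall>b'. e_op B i b = Some b' \<longrightarrow> b' \<in> verts B) \<and>
     (\<forall>i. \<forall>b \<in> verts B. \<forall>b'. f_op B i b = Some b' \<longrightarrow> b' \<in> verts B) \<and>
     (\<forall>i. \<forall>b \<in> verts B.
        phi B i b + eps B i b = (if weight_form (wt B b) (simple_root i) \<noteq> 0 then 1 else 0)) \<and>
     (\<forall>i. \<forall>b \<in> verts B. \<forall>b'. e_op B i b = Some b' \<longrightarrow>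
        int (eps B i b') = int (eps B i b) - 1 \<and>
        int (phi B i b') = int (phi B i b) + 1 \<and>
        wt B b' = wt B b + simple_root i) \<and>
     (\<forall>i. \<forall>b \<in> verts B. \<forall>b'. f_op B i b = Some b' \<longrightarrow>
        int (eps B i b') = int (eps B i b) + 1 \<and>
        int (phi B i b') = int (phi B i b) - 1 \<and>
        wt B b' = wt B b - simple_root i) \<and>
     (\<forall>i. \<forall>b \<in> verts B. \<forall>b' \<in> verts B. f_op B i b = Some b' \<longleftrightarrow> e_op B i b' = Some b)"

definition crystal_edges :: "'b crystal \<Rightarrow> ('b \<times> 'b) set" where
  "crystal_edges B = {(b, b'). b \<in> verts B \<and> b' \<in> verts B \<and> (\<exists>i. f_op B i b = Some b')}"

definition component :: "'b crystal \<Rightarrow> 'b \<Rightarrow> 'b crystal" where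
  "component B b =
     B\<lparr>verts := {b'. (b, b') \<in> (crystal_edges B \<union> (crystal_edges B)\<inverse>)\<^sup>*}\<rparr>"

definition components :: "'b crystal \<Rightarrow> 'b crystal set" where
  "components B = component B ` verts B"

definition is_crystal_iso :: "('a \<Rightarrow> 'b) \<Rightarrow> 'a crystal \<Rightarrow> 'b crystal \<Rightarrow> bool" where
  "is_crystal_iso \<psi> A B \<longleftrightarrow>
     gl_crystal A \<and> gl_crystal B \<and>
     bij_betw \<psi> (verts A) (verts B) \<and>
     (\<forall>i. \<forall>a \<in> verts A. \<forall>a' \<in> verts A.
        f_op A i a = Some a' \<longleftrightarrow> f_op B i (\<psi> a) = Some (\<psi> a')) \<and>
     (\<forall>a \<in> verts A. wt B (\<psi> a) = wt A a) \<and>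
     (\<forall>i. \<forall>a \<in> verts A. eps B i (\<psi> a) = eps A i a \<and> phi B i (\<psi> a) = phi A i a)"

definition crystal_isomorphic :: "'a crystal \<Rightarrow> 'b crystal \<Rightarrow> bool" where
  "crystal_isomorphic A B \<longleftrightarrow> (\<exists>\<psi>. is_crystal_iso \<psi> A B)"

definition gl_equivalent :: "'a crystal \<Rightarrow> 'a \<Rightarrow> 'b crystal \<Rightarrow> 'b \<Rightarrow> bool" where
  "gl_equivalent A a B b \<longleftrightarrow>
     gl_crystal A \<and> gl_crystal B \<and> a \<in> verts A \<and> b \<in> verts B \<and>
     (\<exists>\<psi>. is_crystal_iso \<psi> (component A a) (component B b) \<and> \<psi> a = b)"


section \<open>The crystal of words\<close>

type_synonym word = "half list"

definition letter_e :: "half \<Rightarrow> half \<Rightarrow> half option" where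
  "letter_e i a = (if a = plus_half i then Some i else None)"

definition letter_f :: "half \<Rightarrow> half \<Rightarrow> half option" where
  "letter_f i a = (if a = i then Some (plus_half i) else None)"

definition active_position :: "half \<Rightarrow> word \<Rightarrow> nat option" where
  "active_position i w =
     (let K = {k. k < length w \<and> w ! k \<in> {i, plus_half i}} in
      if K = {} then None else Some (if is_integer i then Min K else Max K))"

definition apply_active :: "(half \<Rightarrow> half option) \<Rightarrow> half \<Rightarrow> word \<Rightarrow> word option" where
  "apply_active g i w =
     (case active_position i w of
        None \<Rightarrow> None
      | Some k \<Rightarrow> map_option (\<lambda>a. w[k := a]) (g (w ! k)))"

definition word_e :: "half \<Rightarrow> word \<Rightarrow> word option" where
  "word_e i w = apply_active (letter_e i) i w"

definition word_f :: "half \<Rightarrow> word \<Rightarrow> word option" where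
  "word_f i w = apply_active (letter_f i) i w"

definition word_crystal :: "word crystal" where
  "word_crystal =
     \<lparr>verts = UNIV,
      wt = (\<lambda>w. \<Sum>a\<leftarrow>w. basis_weight a),
      eps = (\<lambda>i w. if word_e i w \<noteq> None then 1 else 0),
      phi = (\<lambda>i w. if word_f i w \<noteq> None then 1 else 0),
      e_op = word_e,
      f_op = word_f\<rparr>"


section \<open>Quasi-ribbon tableaux\<close>

text \<open>
  A filling of a ribbon is given by the list of its rows from top to bottom, each row being
  listed from left to right. As rows are nonempty, the list of rows determines the ribbon;
  \<open>concat T\<close> lists the entries from northwest to southeast.
\<close>

type_synonym tableau = "half list list"

definition composition :: "nat list \<Rightarrow> bool" where
  "composition \<alpha> \<longleftrightarrow> (\<forall>n \<in> set \<alpha>. n > 0)"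

definition shape :: "tableau \<Rightarrow> nat list" where
  "shape T = map length T"

text \<open>
  Two nodes of a ribbon are vertically adjacent exactly when they are the last node of a row
  and the first node of the next row; the column conditions are stated for such pairs.
\<close>

definition quasi_ribbon :: "tableau \<Rightarrow> bool" where
  "quasi_ribbon T \<longleftrightarrow>
     composition (shape T) \<and>
     (\<forall>R \<in> set T. sorted_wrt (\<lambda>a b. a \<le> b \<and> (\<not> is_integer a \<and> \<not> is_integer b \<longrightarrow> a < b)) R) \<and>
     (\<forall>r. Suc r < length T \<longrightarrow>
        last (T ! r) \<le> hd (T ! Suc r) \<and>
        (is_integer (last (T ! r)) \<and> is_integer (hd (T ! Suc r)) \<longrightarrow>
           last (T ! r) < hd (T ! Suc r)))"

definition quasi_ribbon_tableaux :: "nat list \<Rightarrow> tableau set" where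
  "quasi_ribbon_tableaux \<alpha> = {T. shape T = \<alpha> \<and> quasi_ribbon T}"

definition reading_word :: "tableau \<Rightarrow> word" where
  "reading_word T = concat (map rev T)"

definition tableau_of_word :: "nat list \<Rightarrow> word \<Rightarrow> tableau" where
  "tableau_of_word \<alpha> w = (THE T. shape T = \<alpha> \<and> reading_word T = w)"

text \<open>
  The operators act on reading words; the result is read back as a filling of the same shape.
  That it is again a quasi-ribbon tableau is part of the requirement
  \<open>gl_crystal (tableau_crystal \<alpha>)\<close>, which \<open>is_crystal_iso\<close> and \<open>gl_equivalent\<close> include.
\<close>

definition tableau_crystal :: "nat list \<Rightarrow> tableau crystal" where
  "tableau_crystal \<alpha> =
     \<lparr>verts = quasi_ribbon_tableaux \<alpha>,
      wt = (\<lambda>T. wt word_crystal (reading_word T)),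
      eps = (\<lambda>i T. eps word_crystal i (reading_word T)),
      phi = (\<lambda>i T. phi word_crystal i (reading_word T)),
      e_op = (\<lambda>i T. map_option (tableau_of_word \<alpha>) (word_e i (reading_word T))),
      f_op = (\<lambda>i T. map_option (tableau_of_word \<alpha>) (word_f i (reading_word T)))\<rparr>"


section \<open>Insertion\<close>

text \<open>The sub-tableau of the first \<open>m\<close> nodes, and that of all the other nodes.\<close>

primrec take_nodes :: "nat \<Rightarrow> tableau \<Rightarrow> tableau" where
  "take_nodes m [] = []"
| "take_nodes m (R # T) =
     (if m = 0 then []
      else if m \<le> length R then [take m R]
      else R # take_nodes (m - length R) T)"

primrec drop_nodes :: "nat \<Rightarrow> tableau \<Rightarrow> tableau" where
  "drop_nodes m [] = []"
| "drop_nodes m (R # T) =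
     (if m < length R then drop m R # T else drop_nodes (m - length R) T)"

text \<open>The number \<open>k - 1\<close> of nodes preceding the inserted one.\<close>

definition insert_position :: "half \<Rightarrow> tableau \<Rightarrow> nat" where
  "insert_position b T =
     length (takeWhile (\<lambda>t. \<not> (if is_integer b then b \<le> t else b < t)) (concat T))"

text \<open>The new node is below the nodes kept in front of it, so it starts a row.\<close>

definition insert_letter :: "half \<Rightarrow> tableau \<Rightarrow> tableau" where
  "insert_letter b T =
     (let m = insert_position b T in
      take_nodes m T @
      (case drop_nodes m T of
         [] \<Rightarrow> [[b]]
       | R # T' \<Rightarrow> (b # R) # T'))"

definition P_tableau :: "word \<Rightarrow> tableau" where
  "P_tableau w = foldl (\<lambda>T b. insert_letter b T) [] w"

end

theory Submission
  imports Defs "HOL-Library.Multiset"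
begin

text \<open>
  Sort the positions of a word by letter, breaking ties from right to left for integers and from
  left to right for odd letters. The resulting permutation is unchanged by the crystal operators,
  and \<open>e\<^sub>i\<close>, \<open>f\<^sub>i\<close> act by changing a single entry of the sorted word, in a way that depends only on
  the sorted word and on the descents of the permutation. Insertion computes exactly these data:
  the entries of \<open>P(w)\<close> from northwest to southeast are the sorted word, and two consecutive nodes
  lie in the same row precisely at the descents. Hence \<open>P\<close> is an isomorphism from the words with a
  given permutation onto the tableaux of a given shape. These words form a single component: given
  two of them, the larger of the letters at the first place where the sorted words differ can be
  lowered by some \<open>e\<^sub>i\<close>.
\<close>

subsection \<open>Half-integers\<close>

text \<open>The permutation survives \<open>e\<^sub>i\<close> and \<open>f\<^sub>i\<close> because
  \<open>i\<close> and \<open>i + 1/2\<close> have opposite parities. For an integer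
  \<open>i\<close>, the occurrences of \<open>i\<close> are sorted from right to left and those of
  \<open>i + 1/2\<close> from left to right. So the leftmost letter of the pair either closes the
  block of \<open>i\<close> or opens the block of \<open>i + 1/2\<close>, and exchanging one letter
  for the other does not move it. For odd \<open>i\<close> all directions are reversed. Conversely,
  this border is the only place where both letters fit, so the action can be tested on the sorted
  word. Tableaux are handled as words: the reading words of the quasi-ribbon tableaux of shape
  \<alpha> are exactly the words sorted by one particular permutation, whose descents are the row
  neighbours of the ribbon. Both crystals thus share one connectedness argument. The permutation of
  a given word is not found by sorting; it grows along with the insertion, each new letter
  contributing the largest index.\<close>

definition doubled :: "half \<Rightarrow> nat" where
  "doubled a = nat \<lfloor>2 * rat_of_half a\<rfloor>"

lemma rat_of_half_doubled: "rat_of_half a = of_nat (doubled a) / 2"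
proof -
  obtain n :: nat where "rat_of_half a = of_nat n / 2"
    using rat_of_half[of a] by blast
  moreover from this have "2 * rat_of_half a = of_int (int n)" by simp
  then have "doubled a = n" by (simp only: doubled_def floor_of_int nat_int)
  ultimately show ?thesis by simp
qed

lemma doubled_plus_half [simp]: "doubled (plus_half a) = Suc (doubled a)"
proof -
  have "(of_nat (doubled (plus_half a)) :: rat) = of_nat (Suc (doubled a))"
    using rat_of_half_plus_half[of a] by (simp add: rat_of_half_doubled)
  then show ?thesis by (simp only: of_nat_eq_iff)
qed

lemma less_half_iff: "a < b \<longleftrightarrow> doubled a < doubled b"
  by (simp add: less_half_def rat_of_half_doubled)

lemma less_eq_half_iff: "a \<le> b \<longleftrightarrow> doubled a \<le> doubled b"
  by (simp add: less_eq_half_def rat_of_half_doubled)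

lemma half_eq_iff: "a = b \<longleftrightarrow> doubled a = doubled b"
  by (metis less_eq_half_iff order.antisym order.refl)

lemma is_integer_plus_half [simp]: "is_integer (plus_half a) \<longleftrightarrow> \<not> is_integer a"
proof -
  have *: "is_integer b \<longleftrightarrow> even (doubled b)" for b
  proof
    assume "is_integer b"
    then obtain m where "rat_of_half b = of_int m"
      by (auto simp: is_integer_def elim: Ints_cases)
    then have "(of_int (int (doubled b)) :: rat) = of_int (2 * m)"
      by (simp add: rat_of_half_doubled field_simps)
    then have "int (doubled b) = 2 * m" by (simp only: of_int_eq_iff)
    then show "even (doubled b)" by presburger
  next
    assume "even (doubled b)"
    then show "is_integer b"
      by (auto simp: is_integer_def rat_of_half_doubled elim!: evenE)
  qed
  show ?thesis by (simp add: *)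
qed

lemma plus_half_neq [simp]: "plus_half a \<noteq> a" "a \<noteq> plus_half a"
  by (auto simp: half_eq_iff)

text \<open>A letter below \<open>b\<close> rules out \<open>b = 1/2\<close>, the only letter
  without a predecessor.\<close>

lemma less_imp_plus_half:
  assumes "a < b"
  obtains i where "b = plus_half i" "a \<le> i"
proof -
  have d: "doubled a < doubled b" using assms by (simp add: less_half_iff)
  have "0 < doubled a"
    using rat_of_half[of a] by (auto simp: rat_of_half_doubled)
  define i where "i = half_of_rat (of_nat (doubled b - 1) / 2)"
  have "rat_of_half i = of_nat (doubled b - 1) / 2"
    unfolding i_def using d \<open>0 < doubled a\<close>
    by (intro half_of_rat_inverse) (auto intro!: exI[of _ "doubled b - 1"])
  then have "doubled i = doubled b - 1" by (simp add: rat_of_half_doubled)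
  then show thesis using d by (intro that[of i]) (auto simp: half_eq_iff less_eq_half_iff)
qed


subsection \<open>Crystals\<close>

lemma gl_crystalD:
  assumes "gl_crystal B" "b \<in> verts B"
  shows "phi B i b + eps B i b = (if weight_form (wt B b) (simple_root i) \<noteq> 0 then 1 else 0)"
    and "e_op B i b = Some b' \<Longrightarrow> int (eps B i b') = int (eps B i b) - 1 \<and>
      int (phi B i b') = int (phi B i b) + 1 \<and> wt B b' = wt B b + simple_root i"
    and "f_op B i b = Some b' \<Longrightarrow> int (eps B i b') = int (eps B i b) + 1 \<and>
      int (phi B i b') = int (phi B i b) - 1 \<and> wt B b' = wt B b - simple_root i"
    and "b' \<in> verts B \<Longrightarrow> f_op B i b = Some b' \<longleftrightarrow> e_op B i b' = Some b"
  using assms unfolding gl_crystal_def by blast+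

lemma gl_crystal_restrict:
  assumes B: "gl_crystal B" and S: "S \<subseteq> verts B"
    and closed: "\<And>i b b'. b \<in> S \<Longrightarrow> e_op B i b = Some b' \<Longrightarrow> b' \<in> S"
      "\<And>i b b'. b \<in> S \<Longrightarrow> f_op B i b = Some b' \<Longrightarrow> b' \<in> S"
  shows "gl_crystal (B\<lparr>verts := S\<rparr>)"
proof -
  have sel: "verts (B\<lparr>verts := S\<rparr>) = S" "wt (B\<lparr>verts := S\<rparr>) = wt B" "eps (B\<lparr>verts := S\<rparr>) = eps B"
    "phi (B\<lparr>verts := S\<rparr>) = phi B" "e_op (B\<lparr>verts := S\<rparr>) = e_op B" "f_op (B\<lparr>verts := S\<rparr>) = f_op B"
    by simp_all
  note D = gl_crystalD[OF B subsetD[OF S]]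
  show ?thesis
    unfolding gl_crystal_def sel
  proof (intro conjI allI ballI impI, goal_cases)
    case (1 i b b')
    then show ?case by (rule closed(1))
  next
    case (2 i b b')
    then show ?case by (rule closed(2))
  next
    case (3 i b)
    then show ?case by (rule D(1))
  next
    \<comment> \<open>Goals 4 to 9, left to the end, are the six equations for \<open>eps\<close>,
      \<open>phi\<close> and \<open>wt\<close> along an arrow.\<close>
    case (10 i b b')
    then show ?case using D(4) S by blast
  qed (use D(2,3) in \<open>simp_all\<close>)
qed


subsection \<open>Words\<close>

text \<open>Minimum and maximum merge into one condition in which the parity of \<open>i\<close>
  dictates the truth value of \<open>p < p'\<close>, the form in which tie-breaking will be compared
  with it.\<close>

lemma active_position_eq_Some_iff:
  "active_position i w = Some p \<longleftrightarrow>
     p < length w \<and> w ! p \<in> {i, plus_half i} \<and>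
     (\<forall>p' < length w. w ! p' \<in> {i, plus_half i} \<longrightarrow> p' \<noteq> p \<longrightarrow> (is_integer i \<longleftrightarrow> p < p'))"
proof -
  define K where "K = {k. k < length w \<and> w ! k \<in> {i, plus_half i}}"
  have fin: "finite K" by (simp add: K_def)
  have "active_position i w = Some p \<longleftrightarrow> K \<noteq> {} \<and> (if is_integer i then Min K else Max K) = p"
    unfolding active_position_def K_def[symmetric] Let_def by auto
  also have "\<dots> \<longleftrightarrow> p \<in> K \<and> (\<forall>p' \<in> K. p' \<noteq> p \<longrightarrow> (is_integer i \<longleftrightarrow> p < p'))"
    using fin
    by (cases "K = {}"; cases "is_integer i") (auto simp: Min_eq_iff Max_eq_iff order_le_less)
  finally show ?thesis by (auto simp: K_def)
qed

lemma active_position_eq_None_iff: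
  "active_position i w = None \<longleftrightarrow> i \<notin> set w \<and> plus_half i \<notin> set w"
  by (auto simp: active_position_def Let_def in_set_conv_nth)

lemma active_position_update:
  assumes "active_position i w = Some p" "a \<in> {i, plus_half i}"
  shows "active_position i (w[p := a]) = Some p"
  using assms by (auto simp: active_position_eq_Some_iff nth_list_update)

lemma word_f_eq_Some_iff:
  "word_f i w = Some w' \<longleftrightarrow>
     (\<exists>p. active_position i w = Some p \<and> w ! p = i \<and> w' = w[p := plus_half i])"
  by (auto simp: word_f_def apply_active_def letter_f_def split: option.splits)

lemma word_e_eq_Some_iff:
  "word_e i w = Some w' \<longleftrightarrow>
     (\<exists>p. active_position i w = Some p \<and> w ! p = plus_half i \<and> w' = w[p := i])"
  by (auto simp: word_e_def apply_active_def letter_e_def split: option.splits)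

lemma word_f_iff_word_e: "word_f i w = Some w' \<longleftrightarrow> word_e i w' = Some w"
proof
  assume "word_f i w = Some w'"
  then obtain p where "active_position i w = Some p" "w ! p = i" "w' = w[p := plus_half i]"
    by (auto simp: word_f_eq_Some_iff)
  then show "word_e i w' = Some w"
    using active_position_update[of i w p "plus_half i"]
    by (auto simp: word_e_eq_Some_iff active_position_eq_Some_iff intro!: exI[of _ p])
next
  assume "word_e i w' = Some w"
  then obtain p where "active_position i w' = Some p" "w' ! p = plus_half i" "w = w'[p := i]"
    by (auto simp: word_e_eq_Some_iff)
  then show "word_f i w = Some w'"
    using active_position_update[of i w' p i]
    by (auto simp: word_f_eq_Some_iff active_position_eq_Some_iff intro!: exI[of _ p])
      (metis list_update_id)
qed

lemma word_e_word_f_exclusive: "word_e i w = None \<or> word_f i w = None"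
proof (rule ccontr)
  assume "\<not> ?thesis"
  then obtain v v' where "word_e i w = Some v" "word_f i w = Some v'" by auto
  then show False by (metis option.inject plus_half_neq(1) word_e_eq_Some_iff word_f_eq_Some_iff)
qed

lemma word_e_word_f_None_iff:
  "word_e i w = None \<and> word_f i w = None \<longleftrightarrow> i \<notin> set w \<and> plus_half i \<notin> set w"
proof -
  have *: "active_position i w = None \<longleftrightarrow> i \<notin> set w \<and> plus_half i \<notin> set w"
    by (rule active_position_eq_None_iff)
  show ?thesis
  proof (cases "active_position i w")
    case None
    then show ?thesis using * by (simp add: word_e_def word_f_def apply_active_def)
  next
    case (Some p)
    then have "w ! p = i \<or> w ! p = plus_half i" by (simp add: active_position_eq_Some_iff)
    with Some have "word_e i w \<noteq> None \<or> word_f i w \<noteq> None"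
      by (metis option.distinct(1) word_e_eq_Some_iff word_f_eq_Some_iff)
    moreover have "\<not> (i \<notin> set w \<and> plus_half i \<notin> set w)" using * Some by simp
    ultimately show ?thesis by blast
  qed
qed

section \<open>Weights and the crystal axioms for words\<close>

lemma lookup_sum_basis_weight:
  "Poly_Mapping.lookup (\<Sum>a\<leftarrow>w. basis_weight a) b = int (count_list w b)"
  by (induction w) (auto simp: basis_weight_def lookup_add lookup_single when_def)

text \<open>The minus sign of the root cancels against the opposite parity of the two letters, so
  both terms carry the same sign. For a word the form is then, up to sign, a number of letters, and
  vanishes only if neither letter occurs.\<close>

lemma weight_form_simple_root:
  "weight_form x (simple_root i) =
     (- 1) ^ parity i * (Poly_Mapping.lookup x i + Poly_Mapping.lookup x (plus_half i))"
proof -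
  have root: "Poly_Mapping.lookup (simple_root i) a =
      (if a = i then 1 else if a = plus_half i then - 1 else 0)" for a
    by (auto simp: simple_root_def basis_weight_def lookup_minus lookup_single when_def)
  \<comment> \<open>Off the keys of \<open>x\<close> its own coefficient vanishes, off the pair that
    of the root; both index sets give the same sum.\<close>
  have "weight_form x (simple_root i) =
      (\<Sum>a \<in> {i, plus_half i}. (- 1) ^ parity a * Poly_Mapping.lookup x a *
         Poly_Mapping.lookup (simple_root i) a)"
    unfolding weight_form_def
    by (rule sum.mono_neutral_cong) (auto simp: root in_keys_iff)
  then show ?thesis by (cases "is_integer i") (simp_all add: root parity_def)
qed

lemma sum_list_basis_weight_update:
  assumes "p < length w"
  shows "(\<Sum>a\<leftarrow>w[p := b]. basis_weight a) =
    (\<Sum>a\<leftarrow>w. basis_weight a) + basis_weight b - basis_weight (w ! p)"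
proof -
  have "(\<Sum>a\<leftarrow>w. basis_weight a) =
      (\<Sum>a\<leftarrow>take p w. basis_weight a) + basis_weight (w ! p) + (\<Sum>a\<leftarrow>drop (Suc p) w. basis_weight a)"
    using assms by (subst id_take_nth_drop[of p w]) simp_all
  then show ?thesis using assms by (simp add: upd_conv_take_nth_drop algebra_simps)
qed

lemma sum_word_f:
  assumes "word_f i w = Some w'"
  shows "(\<Sum>a\<leftarrow>w'. basis_weight a) = (\<Sum>a\<leftarrow>w. basis_weight a) - simple_root i"
  using assms
  by (auto simp: word_f_eq_Some_iff active_position_eq_Some_iff sum_list_basis_weight_update
      simple_root_def)

lemma gl_crystal_word_crystal: "gl_crystal word_crystal"
proof -
  have 1: "(if word_f i w \<noteq> None then 1 else 0) + (if word_e i w \<noteq> None then 1 else 0) =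
      (if weight_form (\<Sum>a\<leftarrow>w. basis_weight a) (simple_root i) \<noteq> 0 then 1 else (0 :: nat))" for i w
  proof -
    have "weight_form (\<Sum>a\<leftarrow>w. basis_weight a) (simple_root i) = 0 \<longleftrightarrow>
        i \<notin> set w \<and> plus_half i \<notin> set w"
      by (simp add: weight_form_simple_root lookup_sum_basis_weight count_list_0_iff
          add_nonneg_eq_0_iff)
    then show ?thesis
      using word_e_word_f_None_iff[of i w] word_e_word_f_exclusive[of i w] by auto
  qed
  \<comment> \<open>An arrow is reversible and excludes its partner at either end, so
    \<open>eps\<close> and \<open>phi\<close> exchange the values 0 and 1 along it.\<close>
  have 2: "word_e i w = None \<and> word_f i w \<noteq> None \<and> word_e i w' \<noteq> None \<and> word_f i w' = None"
    if "word_f i w = Some w'" for i w w'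
    using that word_f_iff_word_e[of i w w'] word_e_word_f_exclusive[of i w]
      word_e_word_f_exclusive[of i w'] by auto
  have 3: "(\<Sum>a\<leftarrow>w'. basis_weight a) = (\<Sum>a\<leftarrow>w. basis_weight a) + simple_root i"
    if "word_e i w = Some w'" for i w w'
    using sum_word_f[of i w' w] that by (simp add: word_f_iff_word_e)
  have 4: "word_f i w = None \<and> word_e i w \<noteq> None \<and> word_f i w' \<noteq> None \<and> word_e i w' = None"
    if "word_e i w = Some w'" for i w w'
    using 2[of i w' w] that by (simp add: word_f_iff_word_e)
  have eps_phi: "eps word_crystal i w = (if word_e i w \<noteq> None then 1 else 0)"
    "phi word_crystal i w = (if word_f i w \<noteq> None then 1 else 0)" for i w
    by (simp_all add: word_crystal_def)
  have ops: "e_op word_crystal = word_e" "f_op word_crystal = word_f" "verts word_crystal = UNIV"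
    "wt word_crystal w = (\<Sum>a\<leftarrow>w. basis_weight a)" for w
    by (simp_all add: word_crystal_def)
  show ?thesis
    unfolding gl_crystal_def eps_phi ops
  proof (intro conjI allI ballI impI)
    fix i w w'
    assume e: "word_e i w = Some w'"
    show "int (if word_e i w' \<noteq> None then 1 else 0) = int (if word_e i w \<noteq> None then 1 else 0) - 1"
      "int (if word_f i w' \<noteq> None then 1 else 0) = int (if word_f i w \<noteq> None then 1 else 0) + 1"
      "(\<Sum>a\<leftarrow>w'. basis_weight a) = (\<Sum>a\<leftarrow>w. basis_weight a) + simple_root i"
      using 3[OF e] 4[OF e] by simp_all
  next
    fix i w w'
    assume f: "word_f i w = Some w'"
    show "int (if word_e i w' \<noteq> None then 1 else 0) = int (if word_e i w \<noteq> None then 1 else 0) + 1"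
      "int (if word_f i w' \<noteq> None then 1 else 0) = int (if word_f i w \<noteq> None then 1 else 0) - 1"
      "(\<Sum>a\<leftarrow>w'. basis_weight a) = (\<Sum>a\<leftarrow>w. basis_weight a) - simple_root i"
      using 2[OF f] sum_word_f[OF f] by simp_all
  qed (use 1 word_f_iff_word_e in blast)+
qed


subsection \<open>Standardisation\<close>

text \<open>True \<open>c\<close> is the row rule of a tableau, false \<open>c\<close> the column
  rule. The same boolean will record whether two positions occur in reverse order, so tableau
  conditions and tie-breaking are one relation.\<close>

definition ribbon_step :: "bool \<Rightarrow> half \<Rightarrow> half \<Rightarrow> bool" where
  "ribbon_step c a b \<longleftrightarrow> a \<le> b \<and> (a = b \<longrightarrow> (is_integer a \<longleftrightarrow> c))"

text \<open>A letter \<open>v\<close> outside the pair lies above both its letters. Inside the pair,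
  the last hypothesis forbids a repeated \<open>i\<close>, so \<open>v\<close> is
  \<open>i + 1/2\<close>, which admits either letter in front of it.\<close>

lemma ribbon_step_shift_left:
  assumes "ribbon_step c u v" "u \<in> {i, plus_half i}" "a \<in> {i, plus_half i}"
    "v \<in> {i, plus_half i} \<Longrightarrow> is_integer i \<longleftrightarrow> \<not> c"
  shows "ribbon_step c a v"
proof (cases "v \<in> {i, plus_half i}")
  case True
  then show ?thesis using assms by (auto simp: ribbon_step_def less_eq_half_iff)
next
  case False
  then have "i \<noteq> v" "plus_half i \<noteq> v" "i \<le> v"
    using assms by (auto simp: ribbon_step_def less_eq_half_iff)
  then have "plus_half i < v" by (auto simp: half_eq_iff less_half_iff less_eq_half_iff)
  then have "a < v" using assms(3) \<open>i \<le> v\<close> \<open>i \<noteq> v\<close> by auto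
  then show ?thesis by (auto simp: ribbon_step_def)
qed

text \<open>Mirror image: now a repeated \<open>i + 1/2\<close> is forbidden, so a letter of the
  pair on the left must be \<open>i\<close>.\<close>

lemma ribbon_step_shift_right:
  assumes "ribbon_step c v u" "u \<in> {i, plus_half i}" "a \<in> {i, plus_half i}"
    "v \<in> {i, plus_half i} \<Longrightarrow> is_integer i \<longleftrightarrow> c"
  shows "ribbon_step c v a"
proof (cases "v \<in> {i, plus_half i}")
  case True
  then show ?thesis using assms by (auto simp: ribbon_step_def less_eq_half_iff)
next
  case False
  then have "i \<noteq> v" "plus_half i \<noteq> v" "v \<le> plus_half i"
    using assms by (auto simp: ribbon_step_def less_eq_half_iff)
  then have "v < i" by (auto simp: half_eq_iff less_half_iff less_eq_half_iff)
  then have "v < a" using assms(3) by (auto simp: less_half_iff)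
  then show ?thesis by (auto simp: ribbon_step_def)
qed

text \<open>Equal ends make all three letters equal; their parity then sends both comparisons of
  positions the same way, and these compose.\<close>

lemma ribbon_step_trans:
  assumes "ribbon_step (y < x) a b" "ribbon_step (z < y) b c"
  shows "ribbon_step (z < (x :: nat)) a c"
  using assms unfolding ribbon_step_def by (metis less_trans order.antisym order.trans not_less_iff_gr_or_eq)

text \<open>The tie-breaking order on distinct positions. On the diagonal it holds exactly for odd
  letters, so it is neither reflexive nor irreflexive.\<close>

definition precedes :: "word \<Rightarrow> nat \<Rightarrow> nat \<Rightarrow> bool" where
  "precedes w x y \<longleftrightarrow> ribbon_step (y < x) (w ! x) (w ! y)"

text \<open>
  A permutation is the list \<open>q\<close> of its values; it sorts \<open>w\<close> if \<open>map ((!) w) q\<close> is the sorted word.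
  So a descent is a pair of consecutive sorted letters that stand in \<open>w\<close> in reverse order.
\<close>

definition index_perm :: "nat list \<Rightarrow> bool" where
  "index_perm q \<longleftrightarrow> distinct q \<and> set q = {..<length q}"

definition descent :: "nat list \<Rightarrow> nat \<Rightarrow> bool" where
  "descent q k \<longleftrightarrow> Suc k < length q \<and> q ! Suc k < q ! k"

definition ribbon_sorted :: "(nat \<Rightarrow> bool) \<Rightarrow> half list \<Rightarrow> bool" where
  "ribbon_sorted D s \<longleftrightarrow> (\<forall>k. Suc k < length s \<longrightarrow> ribbon_step (D k) (s ! k) (s ! Suc k))"

lemma transp_precedes: "transp (precedes w)"
  unfolding transp_def precedes_def using ribbon_step_trans by blast

text \<open>By transitivity neighbours suffice, and for neighbours the order of positions is the
  descent. This removes positions from the condition.\<close>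

lemma sorted_wrt_precedes_iff:
  assumes "length w = length q"
  shows "sorted_wrt (precedes w) q \<longleftrightarrow> ribbon_sorted (descent q) (map ((!) w) q)"
  using assms
  by (auto simp: sorted_wrt_iff_nth_Suc_transp[OF transp_precedes] ribbon_sorted_def
      precedes_def descent_def)

section \<open>Sorted words and the action of the operators on them\<close>

lemma index_perm_nth:
  assumes "index_perm q" "p < length q"
  obtains k where "k < length q" "q ! k = p"
  using assms by (metis index_perm_def in_set_conv_nth lessThan_iff)

lemma index_perm_bound: "index_perm q \<Longrightarrow> k < length q \<Longrightarrow> q ! k < length q"
  by (metis index_perm_def nth_mem lessThan_iff)

lemma index_perm_nth_eq_iff:
  "index_perm q \<Longrightarrow> k < length q \<Longrightarrow> l < length q \<Longrightarrow> q ! k = q ! l \<longleftrightarrow> k = l"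
  by (simp add: index_perm_def nth_eq_iff_index_eq)

lemma map_nth_update:
  assumes "index_perm q" "length w = length q" "k < length w"
  shows "map ((!) (w[q ! k := a])) q = (map ((!) w) q)[k := a]"
proof (rule nth_equalityI)
  fix l assume "l < length (map ((!) (w[q ! k := a])) q)"
  then have l: "l < length q" by simp
  then have "q ! l = q ! k \<longleftrightarrow> l = k" "q ! k < length w"
    using assms index_perm_nth_eq_iff[of q l k] index_perm_bound[of q k] by auto
  then show "map ((!) (w[q ! k := a])) q ! l = (map ((!) w) q)[k := a] ! l"
    using l by (cases "l = k") simp_all
qed simp

lemma map_nth_inject:
  assumes "index_perm q" "length w = length q" "length w' = length q"
    "map ((!) w) q = map ((!) w') q"
  shows "w = w'"
proof (rule nth_equalityI)
  fix p assume "p < length w"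
  then have "p \<in> set q" using assms by (simp add: index_perm_def)
  then show "w ! p = w' ! p" using assms(4) by simp
qed (use assms in simp)

lemma map_nth_surj:
  assumes "index_perm q" "length s = length q"
  obtains w where "length w = length q" "map ((!) w) q = s"
proof
  \<comment> \<open>Position \<open>j\<close> receives the letter that \<open>s\<close> has where
    \<open>q\<close> has \<open>j\<close>: the inverse permutation as a lookup table.\<close>
  let ?w = "map (\<lambda>j. the (map_of (zip q s) j)) [0..<length q]"
  show "length ?w = length q" by simp
  show "map ((!) ?w) q = s"
  proof (rule nth_equalityI)
    fix k assume "k < length (map ((!) ?w) q)"
    then have k: "k < length q" by simp
    then have "map_of (zip q s) (q ! k) = Some (s ! k)"
      using assms by (intro map_of_zip_nth) (simp_all add: index_perm_def)
    then show "map ((!) ?w) q ! k = s ! k"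
      using k assms index_perm_bound[of q k] by simp
  qed (use assms in simp)
qed

text \<open>Only comparisons with \<open>p\<close> change. Against another letter of the pair, being
  leftmost or rightmost fixes the order of the two positions, which is exactly the condition of the
  shift lemmas.\<close>

lemma precedes_update_active:
  assumes "active_position i w = Some p" "a \<in> {i, plus_half i}"
    "x < length w" "y < length w" "x \<noteq> y" "precedes w x y"
  shows "precedes (w[p := a]) x y"
proof -
  have p: "w ! p \<in> {i, plus_half i}" "p < length w"
    and act: "\<And>p'. p' < length w \<Longrightarrow> w ! p' \<in> {i, plus_half i} \<Longrightarrow> p' \<noteq> p \<Longrightarrow>
       (is_integer i \<longleftrightarrow> p < p')"
    using assms(1) unfolding active_position_eq_Some_iff by blast+
  consider "x \<noteq> p" "y \<noteq> p" | "x = p" "y \<noteq> p" | "x \<noteq> p" "y = p" using assms by auto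
  then show ?thesis
  proof cases
    case 1
    then show ?thesis using assms by (simp add: precedes_def)
  next
    case 2
    have "ribbon_step (y < p) a (w ! y)"
    proof (rule ribbon_step_shift_left[OF _ p(1) assms(2)])
      show "ribbon_step (y < p) (w ! p) (w ! y)" using assms(6) 2 by (simp add: precedes_def)
      assume "w ! y \<in> {i, plus_half i}"
      then have "is_integer i \<longleftrightarrow> p < y" using act[of y] assms(4) 2 by blast
      then show "is_integer i \<longleftrightarrow> \<not> y < p" using 2 by linarith
    qed
    then show ?thesis using 2 p by (simp add: precedes_def)
  next
    case 3
    have "ribbon_step (p < x) (w ! x) a"
    proof (rule ribbon_step_shift_right[OF _ p(1) assms(2)])
      show "ribbon_step (p < x) (w ! x) (w ! p)" using assms(6) 3 by (simp add: precedes_def)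
      assume "w ! x \<in> {i, plus_half i}"
      then show "is_integer i \<longleftrightarrow> p < x" using act[of x] assms(3) 3 by blast
    qed
    then show ?thesis using 3 p by (simp add: precedes_def)
  qed
qed

lemma sorted_wrt_precedes_update_active:
  assumes "sorted_wrt (precedes w) q" "index_perm q" "length w = length q"
    "active_position i w = Some p" "a \<in> {i, plus_half i}"
  shows "sorted_wrt (precedes (w[p := a])) q"
  unfolding sorted_wrt_iff_nth_less
proof (intro allI impI)
  fix k l assume "k < l" "l < length q"
  with assms show "precedes (w[p := a]) (q ! k) (q ! l)"
    by (intro precedes_update_active)
      (auto simp: index_perm_bound index_perm_nth_eq_iff sorted_wrt_iff_nth_less)
qed

text \<open>Another letter of the pair is confronted with the choice at \<open>p\<close> that forces
  a tie: \<open>i + 1/2\<close> if it comes later in the sorted order, \<open>i\<close> if it comes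
  earlier. The tie-breaking rule then reveals on which side of \<open>p\<close> it stands.\<close>

lemma active_position_if_sorted:
  assumes "index_perm q" "length w = length q" "p < length w" "w ! p \<in> {i, plus_half i}"
    and sorted: "\<And>a. a \<in> {i, plus_half i} \<Longrightarrow> sorted_wrt (precedes (w[p := a])) q"
  shows "active_position i w = Some p"
  unfolding active_position_eq_Some_iff
proof (intro conjI allI impI)
  fix p' assume p': "p' < length w" "w ! p' \<in> {i, plus_half i}" "p' \<noteq> p"
  obtain k l where kl: "k < length q" "q ! k = p" "l < length q" "q ! l = p'"
    using assms p' by (metis index_perm_nth)
  then have "k < l \<or> l < k" using p' by (metis linorder_neqE_nat)
  then show "is_integer i \<longleftrightarrow> p < p'"
  proof
    assume "k < l"
    then have "precedes (w[p := plus_half i]) p p'"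
      using sorted[of "plus_half i"] kl by (auto simp: sorted_wrt_iff_nth_less)
    then show ?thesis using p' assms(3) by (auto simp: precedes_def ribbon_step_def less_eq_half_iff)
  next
    assume "l < k"
    then have "precedes (w[p := i]) p' p"
      using sorted[of i] kl by (auto simp: sorted_wrt_iff_nth_less)
    then show ?thesis using p' assms(3) by (auto simp: precedes_def ribbon_step_def less_eq_half_iff)
  qed
qed (use assms in auto)

text \<open>With \<open>a\<close> the present letter and \<open>b\<close> the other one of the pair,
  raising and lowering are both instances.\<close>

lemma active_position_iff_ribbon_sorted:
  assumes "index_perm q" "length w = length q" "k < length w"
    and "ribbon_sorted (descent q) (map ((!) w) q)"
    and "{a, b} = {i, plus_half i}" "w ! (q ! k) = a"
  shows "active_position i w = Some (q ! k) \<longleftrightarrow>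
    ribbon_sorted (descent q) ((map ((!) w) q)[k := b])"
proof -
  have w: "w[q ! k := a] = w" using assms(6) by (metis list_update_id)
  have iff: "ribbon_sorted (descent q) ((map ((!) w) q)[k := c]) \<longleftrightarrow>
      sorted_wrt (precedes (w[q ! k := c])) q" for c
    using assms by (simp add: sorted_wrt_precedes_iff map_nth_update)
  have s: "sorted_wrt (precedes w) q" using assms by (simp add: sorted_wrt_precedes_iff)
  show ?thesis unfolding iff
  proof
    assume "active_position i w = Some (q ! k)"
    then show "sorted_wrt (precedes (w[q ! k := b])) q"
      using assms s by (intro sorted_wrt_precedes_update_active) auto
  next
    assume "sorted_wrt (precedes (w[q ! k := b])) q"
    then have "sorted_wrt (precedes (w[q ! k := c])) q" if "c \<in> {i, plus_half i}" for c
      using s w assms(5) that by (metis insertE singletonD)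
    moreover have "w ! (q ! k) \<in> {i, plus_half i}" using assms(5,6) by blast
    ultimately show "active_position i w = Some (q ! k)"
      using assms(1-3) index_perm_bound[of q k]
      by (intro active_position_if_sorted[of q]) simp_all
  qed
qed

lemma word_f_eq_Some_iff_ribbon_sorted:
  assumes "index_perm q" "length w = length q" "ribbon_sorted (descent q) (map ((!) w) q)"
  shows "word_f i w = Some w' \<longleftrightarrow>
    (\<exists>k < length q. w ! (q ! k) = i \<and> w' = w[q ! k := plus_half i] \<and>
       ribbon_sorted (descent q) ((map ((!) w) q)[k := plus_half i]))"
proof -
  have *: "active_position i w = Some (q ! k) \<longleftrightarrow>
      ribbon_sorted (descent q) ((map ((!) w) q)[k := plus_half i])"
    if "k < length q" "w ! (q ! k) = i" for k
    using assms that by (intro active_position_iff_ribbon_sorted) simp_all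
  have "word_f i w = Some w' \<longleftrightarrow> (\<exists>k < length q. active_position i w = Some (q ! k) \<and>
      w ! (q ! k) = i \<and> w' = w[q ! k := plus_half i])"
    unfolding word_f_eq_Some_iff using assms
    by (metis active_position_eq_Some_iff index_perm_nth)
  then show ?thesis using * by blast
qed

lemma word_e_eq_Some_iff_ribbon_sorted:
  assumes "index_perm q" "length w = length q" "ribbon_sorted (descent q) (map ((!) w) q)"
  shows "word_e i w = Some w' \<longleftrightarrow>
    (\<exists>k < length q. w ! (q ! k) = plus_half i \<and> w' = w[q ! k := i] \<and>
       ribbon_sorted (descent q) ((map ((!) w) q)[k := i]))"
proof -
  have *: "active_position i w = Some (q ! k) \<longleftrightarrow>
      ribbon_sorted (descent q) ((map ((!) w) q)[k := i])"
    if "k < length q" "w ! (q ! k) = plus_half i" for k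
    using assms that by (intro active_position_iff_ribbon_sorted[where a = "plus_half i"]) auto
  have "word_e i w = Some w' \<longleftrightarrow> (\<exists>k < length q. active_position i w = Some (q ! k) \<and>
      w ! (q ! k) = plus_half i \<and> w' = w[q ! k := i])"
    unfolding word_e_eq_Some_iff using assms
    by (metis active_position_eq_Some_iff index_perm_nth)
  then show ?thesis using * by blast
qed

section \<open>The words with a given permutation as a connected component\<close>

definition std_class :: "nat list \<Rightarrow> word set" where
  "std_class q = {w. length w = length q \<and> sorted_wrt (precedes w) q}"

lemma std_class_iff:
  "w \<in> std_class q \<longleftrightarrow> length w = length q \<and> ribbon_sorted (descent q) (map ((!) w) q)"
  by (auto simp: std_class_def sorted_wrt_precedes_iff)

lemma word_f_std_class:
  assumes "index_perm q" "w \<in> std_class q" "word_f i w = Some w'"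
  shows "w' \<in> std_class q"
  using assms unfolding std_class_iff
  by (metis word_f_eq_Some_iff_ribbon_sorted length_list_update map_nth_update)

lemma word_e_std_class:
  assumes "index_perm q" "w \<in> std_class q" "word_e i w = Some w'"
  shows "w' \<in> std_class q"
  using assms unfolding std_class_iff
  by (metis word_e_eq_Some_iff_ribbon_sorted length_list_update map_nth_update)

text \<open>Letters after place \<open>k\<close> are at least \<open>i + 1/2\<close>, hence stay
  strictly larger. Letters before it are shared with \<open>w\<close>, where they fit in front of a
  letter that is at most \<open>i\<close>; a tie with \<open>i\<close> squeezes that letter to
  \<open>i\<close> and is thus a tie that \<open>w\<close> already admits.\<close>

lemma std_class_lower:
  assumes "index_perm q" "w \<in> std_class q" "w' \<in> std_class q" "k < length q"
    "\<And>l. l < k \<Longrightarrow> w ! (q ! l) = w' ! (q ! l)" "w ! (q ! k) < w' ! (q ! k)"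
  obtains i where "word_e i w' = Some (w'[q ! k := i])" "w' ! (q ! k) = plus_half i"
proof -
  obtain i where i: "w' ! (q ! k) = plus_half i" "w ! (q ! k) \<le> i"
    using assms(6) by (rule less_imp_plus_half)
  have len: "length w' = length q" "length w = length q" using assms by (auto simp: std_class_def)
  have srt: "precedes w (q ! l) (q ! m)" "precedes w' (q ! l) (q ! m)"
    if "l < m" "m < length q" for l m
    using assms that by (auto simp: std_class_def sorted_wrt_iff_nth_less)
  have "sorted_wrt (precedes (w'[q ! k := i])) q"
    unfolding sorted_wrt_iff_nth_less
  proof (intro allI impI)
    fix l m assume lm: "l < m" "m < length q"
    have b: "q ! l < length q" "q ! m < length q" using assms lm by (auto simp: index_perm_bound)
    have neq: "q ! l \<noteq> q ! m" using assms lm by (auto simp: index_perm_nth_eq_iff)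
    consider "l = k" | "m = k" | "q ! l \<noteq> q ! k" "q ! m \<noteq> q ! k"
      using assms(1,4) lm by (auto simp: index_perm_nth_eq_iff)
    then show "precedes (w'[q ! k := i]) (q ! l) (q ! m)"
    proof cases
      case 1
      then have "plus_half i \<le> w' ! (q ! m)"
        using srt(2)[OF lm] i(1) by (simp add: precedes_def ribbon_step_def)
      then have "i < w' ! (q ! m)" by (simp add: less_half_iff less_eq_half_iff)
      then have "ribbon_step (q ! m < q ! k) i (w' ! (q ! m))" by (auto simp: ribbon_step_def)
      then show ?thesis using 1 neq b len by (simp add: precedes_def)
    next
      case 2
      then have "ribbon_step (q ! k < q ! l) (w' ! (q ! l)) (w ! (q ! k))"
        using srt(1)[OF lm] assms(5)[of l] lm by (simp add: precedes_def)
      then have "ribbon_step (q ! k < q ! l) (w' ! (q ! l)) i"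
        using i(2) unfolding ribbon_step_def by (metis order.antisym order.trans)
      then show ?thesis using 2 neq b len by (simp add: precedes_def)
    next
      case 3
      then show ?thesis using srt(2)[OF lm] by (simp add: precedes_def)
    qed
  qed
  then have "ribbon_sorted (descent q) ((map ((!) w') q)[k := i])"
    using assms(1,4) len by (simp add: sorted_wrt_precedes_iff map_nth_update)
  moreover have "ribbon_sorted (descent q) (map ((!) w') q)"
    using assms(3) by (simp add: std_class_iff)
  ultimately have "word_e i w' = Some (w'[q ! k := i])"
    using assms(1,4) len i(1) by (auto simp: word_e_eq_Some_iff_ribbon_sorted)
  then show thesis using i(1) by (rule that)
qed

lemma crystal_edges_word_crystal:
  "(w, w') \<in> crystal_edges word_crystal \<longleftrightarrow> (\<exists>i. word_f i w = Some w')"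
  by (simp add: crystal_edges_def word_crystal_def)

lemma word_e_lowers_size:
  assumes "word_e i w = Some w'"
  shows "sum_list (map doubled w') < sum_list (map doubled w)"
proof -
  obtain p where p: "p < length w" "w ! p = plus_half i" "w' = w[p := i]"
    using assms by (auto simp: word_e_eq_Some_iff active_position_eq_Some_iff)
  have "sum_list (map doubled w) =
      sum_list (map doubled (take p w)) + doubled (w ! p) + sum_list (map doubled (drop (Suc p) w))"
    using p by (subst id_take_nth_drop[of p w]) simp_all
  then show ?thesis using p by (simp add: upd_conv_take_nth_drop)
qed

text \<open>Every step lowers one of the two words, so the total of their doubled letters is an
  induction measure; lowering goes on until the words coincide.\<close>

lemma std_class_connected:
  assumes "index_perm q" "w \<in> std_class q" "w' \<in> std_class q"
  shows "(w, w') \<in> (crystal_edges word_crystal \<union> (crystal_edges word_crystal)\<inverse>)\<^sup>*"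
  using assms(2,3)
proof (induction "sum_list (map doubled w) + sum_list (map doubled w')"
    arbitrary: w w' rule: less_induct)
  case less
  let ?R = "crystal_edges word_crystal \<union> (crystal_edges word_crystal)\<inverse>"
  have e: "(v, v') \<in> ?R" "(v', v) \<in> ?R" if "word_e i v = Some v'" for i v v'
    using that by (auto simp: crystal_edges_word_crystal word_f_iff_word_e)
  show ?case
  proof (cases "w = w'")
    case False
    define k where "k = (LEAST k. k < length q \<and> w ! (q ! k) \<noteq> w' ! (q ! k))"
    have len: "length w = length q" "length w' = length q"
      using less.prems by (auto simp: std_class_def)
    have ex: "\<exists>k. k < length q \<and> w ! (q ! k) \<noteq> w' ! (q ! k)"
    proof (rule ccontr)
      assume "\<not> ?thesis"
      then have "map ((!) w) q = map ((!) w') q"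
        by (intro nth_equalityI) simp_all
      then have "w = w'" by (rule map_nth_inject[OF assms(1) len])
      with False show False by simp
    qed
    have k': "k < length q \<and> w ! (q ! k) \<noteq> w' ! (q ! k)"
      unfolding k_def by (rule LeastI_ex[OF ex])
    then have k: "k < length q" "w ! (q ! k) \<noteq> w' ! (q ! k)" by auto
    have lt: "w ! (q ! l) = w' ! (q ! l)" if "l < k" for l
    proof -
      have "\<not> (l < length q \<and> w ! (q ! l) \<noteq> w' ! (q ! l))"
        using that unfolding k_def by (rule not_less_Least)
      then show ?thesis using that k(1) by simp
    qed
    from k(2) consider "w ! (q ! k) < w' ! (q ! k)" | "w' ! (q ! k) < w ! (q ! k)"
      using linorder_less_linear by blast
    then show ?thesis
    proof cases
      case 1
      then obtain i v where v: "word_e i w' = Some v"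
        using std_class_lower[OF assms(1) less.prems k(1) lt] by blast
      have "(w, v) \<in> ?R\<^sup>*"
        using less.prems word_e_lowers_size[OF v] word_e_std_class[OF assms(1) _ v]
        by (intro less.hyps) simp_all
      from this e(2)[OF v] show ?thesis by (rule rtrancl_into_rtrancl)
    next
      case 2
      then obtain i v where v: "word_e i w = Some v"
        using std_class_lower[OF assms(1) less.prems(2,1) k(1) lt[symmetric]] by blast
      have "(v, w') \<in> ?R\<^sup>*"
        using less.prems word_e_lowers_size[OF v] word_e_std_class[OF assms(1) _ v]
        by (intro less.hyps) simp_all
      with e(1)[OF v] show ?thesis by (rule converse_rtrancl_into_rtrancl)
    qed
  qed simp
qed

lemma verts_component_word_crystal:
  assumes "index_perm q" "w \<in> std_class q"
  shows "verts (component word_crystal w) = std_class q"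
proof -
  have "w' \<in> std_class q"
    if "(w, w') \<in> (crystal_edges word_crystal \<union> (crystal_edges word_crystal)\<inverse>)\<^sup>*" for w'
    using that
  proof induction
    case (step v v')
    then obtain i where "word_f i v = Some v' \<or> word_e i v = Some v'"
      by (auto simp: crystal_edges_word_crystal word_f_iff_word_e)
    then show ?case
      using step.IH word_f_std_class[OF assms(1)] word_e_std_class[OF assms(1)] by blast
  qed (rule assms(2))
  then show ?thesis
    using std_class_connected[OF assms] by (auto simp: component_def)
qed


section \<open>Permutations with equal descents\<close>

lemma sum_list_index_perm:
  fixes f :: "half \<Rightarrow> 'b :: comm_monoid_add"
  assumes "index_perm q" "length w = length q"
  shows "(\<Sum>a\<leftarrow>map ((!) w) q. f a) = (\<Sum>a\<leftarrow>w. f a)"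
proof -
  have "mset q = mset [0..<length w]"
    using assms set_eq_iff_mset_eq_distinct[of q "[0..<length w]"]
    unfolding index_perm_def by (metis atLeast0LessThan distinct_upt set_upt)
  then have "mset (map ((!) w) q) = mset (map ((!) w) [0..<length w])" by simp
  then have "mset (map ((!) w) q) = mset w" by (simp only: map_nth)
  then have "mset (map f (map ((!) w) q)) = mset (map f w)" by (simp only: mset_map)
  then show ?thesis by (metis sum_mset_sum_list)
qed

context
  fixes q q' :: "nat list"
  assumes perm: "index_perm q" "index_perm q'" "length q' = length q" "descent q' = descent q"
begin

lemma sorted_letters_std_class:
  assumes "length v = length q" "map ((!) w) q = map ((!) v) q'" "w \<in> std_class q"
  shows "v \<in> std_class q'"
  using assms perm by (simp add: std_class_iff)

lemma sorted_letters_word_f_iff: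
  assumes "w \<in> std_class q" "length v = length q" "map ((!) w) q = map ((!) v) q'"
    and "w' \<in> std_class q" "length v' = length q" "map ((!) w') q = map ((!) v') q'"
  shows "word_f i w = Some w' \<longleftrightarrow> word_f i v = Some v'"
proof -
  \<comment> \<open>Arrows are restated through sorted words alone, which is possible because a word
    is determined by \<open>r\<close> and its sorted word. What remains depends on \<open>r\<close>
    only through its length and descents.\<close>
  have *: "word_f i u = Some u' \<longleftrightarrow> (\<exists>k < length r. map ((!) u) r ! k = i \<and>
      map ((!) u') r = (map ((!) u) r)[k := plus_half i] \<and>
      ribbon_sorted (descent r) ((map ((!) u) r)[k := plus_half i]))"
    if r: "index_perm r" "u \<in> std_class r" "length u' = length r" for r u u'
  proof -
    have u: "length u = length r" "ribbon_sorted (descent r) (map ((!) u) r)"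
      using r(2) by (simp_all add: std_class_iff)
    have "u' = u[r ! k := c] \<longleftrightarrow> map ((!) u') r = (map ((!) u) r)[k := c]" if "k < length r" for k c
      using map_nth_update[OF r(1) u(1), of k c] map_nth_inject[OF r(1,3), of "u[r ! k := c]"] that u
      by auto
    then show ?thesis
      unfolding word_f_eq_Some_iff_ribbon_sorted[OF r(1) u] by (metis nth_map)
  qed
  have "v \<in> std_class q'" using assms by (intro sorted_letters_std_class)
  moreover have "length w' = length q" using assms(4) by (simp add: std_class_def)
  ultimately show ?thesis
    using *[OF perm(1) assms(1)] *[OF perm(2), of v v'] assms(3,5,6) perm(3,4) by simp
qed

lemma sorted_letters_word_f_None_iff:
  assumes "w \<in> std_class q" "length v = length q" "map ((!) w) q = map ((!) v) q'"
  shows "word_f i w = None \<longleftrightarrow> word_f i v = None"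
proof -
  have *: "word_f i u = None \<longleftrightarrow> \<not> (\<exists>k < length r. map ((!) u) r ! k = i \<and>
      ribbon_sorted (descent r) ((map ((!) u) r)[k := plus_half i]))"
    if r: "index_perm r" "u \<in> std_class r" for r u
  proof -
    have u: "length u = length r" "ribbon_sorted (descent r) (map ((!) u) r)"
      using r(2) by (simp_all add: std_class_iff)
    show ?thesis
      using word_f_eq_Some_iff_ribbon_sorted[OF r(1) u] by (metis not_None_eq nth_map)
  qed
  have "v \<in> std_class q'" using assms by (intro sorted_letters_std_class)
  then show ?thesis
    using *[OF perm(1) assms(1)] *[OF perm(2), of v] assms(3) perm(3,4) by simp
qed

lemma sorted_letters_word_e_None_iff:
  assumes "w \<in> std_class q" "length v = length q" "map ((!) w) q = map ((!) v) q'"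
  shows "word_e i w = None \<longleftrightarrow> word_e i v = None"
proof -
  have *: "word_e i u = None \<longleftrightarrow> \<not> (\<exists>k < length r. map ((!) u) r ! k = plus_half i \<and>
      ribbon_sorted (descent r) ((map ((!) u) r)[k := i]))"
    if r: "index_perm r" "u \<in> std_class r" for r u
  proof -
    have u: "length u = length r" "ribbon_sorted (descent r) (map ((!) u) r)"
      using r(2) by (simp_all add: std_class_iff)
    show ?thesis
      using word_e_eq_Some_iff_ribbon_sorted[OF r(1) u] by (metis not_None_eq nth_map)
  qed
  have "v \<in> std_class q'" using assms by (intro sorted_letters_std_class)
  then show ?thesis
    using *[OF perm(1) assms(1)] *[OF perm(2), of v] assms(3) perm(3,4) by simp
qed

end


subsection \<open>Ribbons\<close>

text \<open>Nodes are numbered from \<open>0\<close>, northwest to southeast; \<open>same_row \<alpha> k\<close> compares \<open>k\<close> with \<open>Suc k\<close>.\<close>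

primrec same_row :: "nat list \<Rightarrow> nat \<Rightarrow> bool" where
  "same_row [] k \<longleftrightarrow> False"
| "same_row (n # \<alpha>) k \<longleftrightarrow> (if k < n then Suc k < n else same_row \<alpha> (k - n))"

text \<open>The entry \<open>k\<close> of this list is the place of node \<open>k\<close> in the reading word.\<close>

primrec reading_order :: "nat list \<Rightarrow> nat list" where
  "reading_order [] = []"
| "reading_order (n # \<alpha>) = rev [0..<n] @ map ((+) n) (reading_order \<alpha>)"

primrec unflatten :: "nat list \<Rightarrow> half list \<Rightarrow> tableau" where
  "unflatten [] s = []"
| "unflatten (n # \<alpha>) s = take n s # unflatten \<alpha> (drop n s)"

lemma shape_unflatten: "length s = sum_list \<alpha> \<Longrightarrow> shape (unflatten \<alpha> s) = \<alpha>"
  by (induction \<alpha> arbitrary: s) (auto simp: shape_def)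

lemma concat_unflatten: "length s = sum_list \<alpha> \<Longrightarrow> concat (unflatten \<alpha> s) = s"
  by (induction \<alpha> arbitrary: s) auto

lemma unflatten_concat: "unflatten (shape T) (concat T) = T"
  by (induction T) (auto simp: shape_def)

lemma length_concat_shape: "length (concat T) = sum_list (shape T)"
  by (simp add: length_concat shape_def)

lemma length_reading_word: "length (reading_word T) = sum_list (shape T)"
  by (simp add: length_concat shape_def reading_word_def comp_def)

lemma length_reading_order [simp]: "length (reading_order \<alpha>) = sum_list \<alpha>"
  by (induction \<alpha>) auto

lemma index_perm_reading_order: "index_perm (reading_order \<alpha>)"
proof (induction \<alpha>)
  case (Cons n \<alpha>)
  have "(+) n ` {..<sum_list \<alpha>} = {n..<n + sum_list \<alpha>}"
    by (simp add: lessThan_atLeast0 add.commute)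
  then show ?case
    using Cons by (auto simp: index_perm_def distinct_map)
qed (simp add: index_perm_def)

text \<open>A row is read backwards, so positions decrease along it, while the next row starts at a
  larger position. From the last node on both sides are false, hence the equality of
  functions.\<close>

lemma descent_reading_order: "descent (reading_order \<alpha>) = same_row \<alpha>"
proof (induction \<alpha>)
  case (Cons n \<alpha>)
  show ?case
  proof
    fix k
    consider "Suc k < n" | "Suc k = n" | "n \<le> k" by linarith
    then show "descent (reading_order (n # \<alpha>)) k = same_row (n # \<alpha>) k"
    proof cases
      case 3
      have "descent (reading_order (n # \<alpha>)) k = descent (reading_order \<alpha>) (k - n)"
        using 3 by (auto simp: descent_def nth_append Suc_diff_le)
      then show ?thesis using 3 Cons by simp
    qed (auto simp: descent_def nth_append rev_nth)
  qed
qed (auto simp: descent_def)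

lemma reading_word_reading_order:
  "map ((!) (reading_word T)) (reading_order (shape T)) = concat T"
proof (induction T)
  case (Cons R T)
  have "map ((!) (rev R @ reading_word T)) [0..<length R] = map ((!) (rev R)) [0..<length (rev R)]"
    by (simp add: nth_append)
  also have "\<dots> = rev R" by (rule map_nth)
  finally have row: "map ((!) (rev R @ reading_word T)) (rev [0..<length R]) = R"
    by (simp add: rev_map[symmetric])
  have rest: "map ((!) (rev R @ reading_word T)) (map ((+) (length R)) (reading_order (shape T))) =
      map ((!) (reading_word T)) (reading_order (shape T))"
    by (simp add: nth_append)
  have "reading_word (R # T) = rev R @ reading_word T" "shape (R # T) = length R # shape T"
    by (simp_all add: reading_word_def shape_def)
  then show ?case by (simp only: reading_order.simps map_append row rest Cons concat.simps)
qed (simp add: shape_def)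

section \<open>Quasi-ribbon tableaux as sorted words\<close>

lemma ribbon_sorted_Nil [simp]: "ribbon_sorted D []"
  by (simp add: ribbon_sorted_def)

lemma ribbon_sorted_Cons:
  "ribbon_sorted D (x # s) \<longleftrightarrow>
     (s \<noteq> [] \<longrightarrow> ribbon_step (D 0) x (hd s)) \<and> ribbon_sorted (\<lambda>k. D (Suc k)) s"
proof -
  have "(\<forall>k. P k) \<longleftrightarrow> P 0 \<and> (\<forall>k. P (Suc k))" for P :: "nat \<Rightarrow> bool"
    by (metis not0_implies_Suc)
  from this[of "\<lambda>k. Suc k < length (x # s) \<longrightarrow> ribbon_step (D k) ((x # s) ! k) ((x # s) ! Suc k)"]
  show ?thesis by (simp add: ribbon_sorted_def hd_conv_nth)
qed

lemma ribbon_sorted_append: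
  "ribbon_sorted D (s @ t) \<longleftrightarrow> ribbon_sorted D s \<and> ribbon_sorted (\<lambda>k. D (k + length s)) t \<and>
     (s \<noteq> [] \<and> t \<noteq> [] \<longrightarrow> ribbon_step (D (length s - 1)) (last s) (hd t))"
proof (induction s arbitrary: D)
  case Nil
  then show ?case by simp
next
  case (Cons x s)
  from Cons[of "\<lambda>k. D (Suc k)"] show ?case by (cases s) (auto simp: ribbon_sorted_Cons)
qed

lemma row_step_iff:
  "a \<le> b \<and> (\<not> is_integer a \<and> \<not> is_integer b \<longrightarrow> a < b) \<longleftrightarrow> ribbon_step True a b"
  by (auto simp: ribbon_step_def order_le_less)

lemma column_step_iff:
  "a \<le> b \<and> (is_integer a \<and> is_integer b \<longrightarrow> a < b) \<longleftrightarrow> ribbon_step False a b"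
  by (auto simp: ribbon_step_def order_le_less)

lemma sorted_wrt_row_iff:
  "sorted_wrt (ribbon_step True) R \<longleftrightarrow> ribbon_sorted (\<lambda>k. Suc k < length R) R"
proof -
  have "transp (ribbon_step True)"
  proof (rule transpI)
    fix a b c assume "ribbon_step True a b" "ribbon_step True b c"
    then show "ribbon_step True a c"
      \<comment> \<open>Positions 2, 1, 0 make all three comparisons true.\<close>
      using ribbon_step_trans[of 1 2 a b 0 c] by simp
  qed
  then show ?thesis by (simp add: sorted_wrt_iff_nth_Suc_transp ribbon_sorted_def)
qed

lemma quasi_ribbon_Cons:
  "quasi_ribbon (R # T) \<longleftrightarrow> R \<noteq> [] \<and> ribbon_sorted (\<lambda>k. Suc k < length R) R \<and> quasi_ribbon T \<and>
     (T \<noteq> [] \<longrightarrow> ribbon_step False (last R) (hd (hd T)))"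
proof -
  have "(\<forall>k. P k) \<longleftrightarrow> P 0 \<and> (\<forall>k. P (Suc k))" for P :: "nat \<Rightarrow> bool"
    by (metis not0_implies_Suc)
  note split = this[of "\<lambda>r. Suc r < length (R # T) \<longrightarrow>
        ribbon_step False (last ((R # T) ! r)) (hd ((R # T) ! Suc r))"]
  show ?thesis
    unfolding quasi_ribbon_def row_step_iff column_step_iff split sorted_wrt_row_iff
    by (cases T) (auto simp: composition_def shape_def)
qed

lemma quasi_ribbon_iff:
  "quasi_ribbon T \<longleftrightarrow> composition (shape T) \<and> ribbon_sorted (same_row (shape T)) (concat T)"
proof (induction T)
  case Nil
  then show ?case by (simp add: quasi_ribbon_def shape_def composition_def ribbon_sorted_def)
next
  case (Cons R T)
  have comp: "composition (shape (R # T)) \<longleftrightarrow> R \<noteq> [] \<and> composition (shape T)"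
    by (auto simp: composition_def shape_def)
  show ?case
  proof (cases "composition (shape (R # T))")
    case True
    then have R: "R \<noteq> []" by (simp add: comp)
    \<comment> \<open>Rows are nonempty, so the first entry of the next row is the first of all
      remaining entries.\<close>
    have T: "hd (hd T) = hd (concat T)" "concat T \<noteq> []" if "T \<noteq> []"
      using that True by (cases T; auto simp: composition_def shape_def)+
    have "ribbon_sorted (same_row (shape (R # T))) (concat (R # T)) \<longleftrightarrow>
        ribbon_sorted (same_row (length R # shape T)) R \<and> ribbon_sorted (same_row (shape T)) (concat T) \<and>
        (concat T \<noteq> [] \<longrightarrow> ribbon_step False (last R) (hd (concat T)))"
      using R by (auto simp: ribbon_sorted_append shape_def)
    also have "ribbon_sorted (same_row (length R # shape T)) R \<longleftrightarrow>
        ribbon_sorted (\<lambda>k. Suc k < length R) R"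
      by (simp add: ribbon_sorted_def)
    finally show ?thesis
      using T True R Cons.IH comp unfolding quasi_ribbon_Cons by (cases "T = []") auto
  next
    case False
    then show ?thesis by (simp add: quasi_ribbon_def)
  qed
qed


subsection \<open>The crystal of quasi-ribbon tableaux\<close>

lemma reading_word_unflatten:
  assumes "length v = sum_list \<alpha>"
  shows "reading_word (unflatten \<alpha> (map ((!) v) (reading_order \<alpha>))) = v"
proof -
  let ?T = "unflatten \<alpha> (map ((!) v) (reading_order \<alpha>))"
  have T: "shape ?T = \<alpha>" "concat ?T = map ((!) v) (reading_order \<alpha>)"
    by (simp_all add: shape_unflatten concat_unflatten)
  have "map ((!) (reading_word ?T)) (reading_order \<alpha>) = map ((!) v) (reading_order \<alpha>)"
    using reading_word_reading_order[of ?T] unfolding T .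
  moreover have "length (reading_word ?T) = length (reading_order \<alpha>)" "length v = length (reading_order \<alpha>)"
    using assms T by (simp_all add: length_reading_word)
  ultimately show ?thesis using map_nth_inject[OF index_perm_reading_order] by blast
qed

text \<open>The definite description is resolved: the reading order recovers the entries from the
  word, and the shape cuts them into rows.\<close>

lemma tableau_of_word_eq:
  assumes "length v = sum_list \<alpha>"
  shows "tableau_of_word \<alpha> v = unflatten \<alpha> (map ((!) v) (reading_order \<alpha>))"
  unfolding tableau_of_word_def
proof (rule the_equality)
  show "shape (unflatten \<alpha> (map ((!) v) (reading_order \<alpha>))) = \<alpha> \<and>
      reading_word (unflatten \<alpha> (map ((!) v) (reading_order \<alpha>))) = v"
    using assms by (simp add: shape_unflatten reading_word_unflatten)
next
  fix T assume "shape T = \<alpha> \<and> reading_word T = v"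
  then show "T = unflatten \<alpha> (map ((!) v) (reading_order \<alpha>))"
    using reading_word_reading_order[of T] unflatten_concat[of T] by simp
qed

lemma reading_word_tableau_of_word:
  assumes "length v = sum_list \<alpha>"
  shows "shape (tableau_of_word \<alpha> v) = \<alpha>" "reading_word (tableau_of_word \<alpha> v) = v"
  using assms by (simp_all add: tableau_of_word_eq shape_unflatten reading_word_unflatten)

lemma tableau_of_word_reading_word: "tableau_of_word (shape T) (reading_word T) = T"
  by (simp add: tableau_of_word_eq length_reading_word reading_word_reading_order unflatten_concat)

text \<open>The tableaux of one shape correspond to a whole class, that of the reading order, so
  closure and connectedness of classes carry over.\<close>

lemma quasi_ribbon_tableaux_iff:
  assumes "composition \<alpha>"
  shows "T \<in> quasi_ribbon_tableaux \<alpha> \<longleftrightarrow>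
    shape T = \<alpha> \<and> reading_word T \<in> std_class (reading_order \<alpha>)"
  using assms reading_word_reading_order[of T]
  by (auto simp: quasi_ribbon_tableaux_def quasi_ribbon_iff std_class_iff length_reading_word
      descent_reading_order)

lemma tableau_of_word_std_class:
  assumes "composition \<alpha>" "v \<in> std_class (reading_order \<alpha>)"
  shows "tableau_of_word \<alpha> v \<in> quasi_ribbon_tableaux \<alpha>" "reading_word (tableau_of_word \<alpha> v) = v"
  using assms reading_word_tableau_of_word[of v \<alpha>]
  by (simp_all add: quasi_ribbon_tableaux_iff std_class_def)

lemma map_option_tableau_of_word:
  assumes "composition \<alpha>"
    and "\<And>v. x = Some v \<Longrightarrow> v \<in> std_class (reading_order \<alpha>)"
  shows "map_option (tableau_of_word \<alpha>) x = Some T \<longleftrightarrow>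
    T \<in> quasi_ribbon_tableaux \<alpha> \<and> x = Some (reading_word T)"
proof
  assume "map_option (tableau_of_word \<alpha>) x = Some T"
  then obtain v where "x = Some v" "T = tableau_of_word \<alpha> v" by auto
  then show "T \<in> quasi_ribbon_tableaux \<alpha> \<and> x = Some (reading_word T)"
    using assms(2)[of v] tableau_of_word_std_class[OF assms(1), of v] by simp
next
  assume "T \<in> quasi_ribbon_tableaux \<alpha> \<and> x = Some (reading_word T)"
  then show "map_option (tableau_of_word \<alpha>) x = Some T"
    using tableau_of_word_reading_word[of T] by (auto simp: quasi_ribbon_tableaux_def)
qed

lemma tableau_crystal_ops:
  assumes "composition \<alpha>" "T \<in> quasi_ribbon_tableaux \<alpha>"
  shows "f_op (tableau_crystal \<alpha>) i T = Some T' \<longleftrightarrow>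
      T' \<in> quasi_ribbon_tableaux \<alpha> \<and> f_op word_crystal i (reading_word T) = Some (reading_word T')"
    and "e_op (tableau_crystal \<alpha>) i T = Some T' \<longleftrightarrow>
      T' \<in> quasi_ribbon_tableaux \<alpha> \<and> e_op word_crystal i (reading_word T) = Some (reading_word T')"
proof -
  have T: "reading_word T \<in> std_class (reading_order \<alpha>)"
    using assms by (simp add: quasi_ribbon_tableaux_iff)
  show "f_op (tableau_crystal \<alpha>) i T = Some T' \<longleftrightarrow>
      T' \<in> quasi_ribbon_tableaux \<alpha> \<and> f_op word_crystal i (reading_word T) = Some (reading_word T')"
    using map_option_tableau_of_word[OF assms(1)] word_f_std_class[OF index_perm_reading_order T]
    by (simp add: tableau_crystal_def word_crystal_def)
  show "e_op (tableau_crystal \<alpha>) i T = Some T' \<longleftrightarrow>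
      T' \<in> quasi_ribbon_tableaux \<alpha> \<and> e_op word_crystal i (reading_word T) = Some (reading_word T')"
    using map_option_tableau_of_word[OF assms(1)] word_e_std_class[OF index_perm_reading_order T]
    by (simp add: tableau_crystal_def word_crystal_def)
qed

lemma tableau_crystal_sel:
  "verts (tableau_crystal \<alpha>) = quasi_ribbon_tableaux \<alpha>"
  "wt (tableau_crystal \<alpha>) T = wt word_crystal (reading_word T)"
  "eps (tableau_crystal \<alpha>) i T = eps word_crystal i (reading_word T)"
  "phi (tableau_crystal \<alpha>) i T = phi word_crystal i (reading_word T)"
  by (simp_all add: tableau_crystal_def)

lemma gl_crystal_tableau_crystal:
  assumes "composition \<alpha>"
  shows "gl_crystal (tableau_crystal \<alpha>)"
proof -
  note ops = tableau_crystal_ops[OF assms]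
  have verts: "w \<in> verts word_crystal" for w by (simp add: word_crystal_def)
  note W = gl_crystalD[OF gl_crystal_word_crystal verts]
  show ?thesis
    unfolding gl_crystal_def tableau_crystal_sel
  proof (intro conjI allI ballI impI, goal_cases)
    case (1 i T T')
    then show ?case using ops(2)[of T i T'] by blast
  next
    case (2 i T T')
    then show ?case using ops(1)[of T i T'] by blast
  next
    case (3 i T)
    show ?case by (rule W(1))
  next
    case (10 i T T')
    then show ?case using ops(1)[of T i T'] ops(2)[of T' i T]
        W(4)[OF verts] by blast
  qed (use ops W(2,3) in \<open>simp_all\<close>)
qed

lemma component_tableau_crystal:
  assumes "composition \<alpha>" "T \<in> quasi_ribbon_tableaux \<alpha>"
  shows "component (tableau_crystal \<alpha>) T = tableau_crystal \<alpha>"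
proof -
  let ?q = "reading_order \<alpha>"
  let ?E = "crystal_edges (tableau_crystal \<alpha>) \<union> (crystal_edges (tableau_crystal \<alpha>))\<inverse>"
  let ?W = "crystal_edges word_crystal \<union> (crystal_edges word_crystal)\<inverse>"
  have edge: "(S, S') \<in> crystal_edges (tableau_crystal \<alpha>)"
    if "S \<in> quasi_ribbon_tableaux \<alpha>" "S' \<in> quasi_ribbon_tableaux \<alpha>"
      "(reading_word S, reading_word S') \<in> crystal_edges word_crystal" for S S'
    using that tableau_crystal_ops(1)[OF assms(1)]
    by (auto simp: crystal_edges_def tableau_crystal_sel)
  \<comment> \<open>A path of words is lifted step by step. Membership in the class is carried
    along, since it makes each intermediate filling a quasi-ribbon tableau.\<close>
  have path: "v \<in> std_class ?q \<and> (T, tableau_of_word \<alpha> v) \<in> ?E\<^sup>*"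
    if "(reading_word T, v) \<in> ?W\<^sup>*" for v
    using that
  proof induction
    case base
    have "shape T = \<alpha>" using assms(2) by (simp add: quasi_ribbon_tableaux_def)
    then show ?case
      using assms tableau_of_word_reading_word[of T] by (simp add: quasi_ribbon_tableaux_iff)
  next
    case (step v v')
    then obtain i where "word_f i v = Some v' \<or> word_e i v = Some v'"
      by (auto simp: crystal_edges_word_crystal word_f_iff_word_e)
    then have v': "v' \<in> std_class ?q"
      using step.IH word_f_std_class[OF index_perm_reading_order]
        word_e_std_class[OF index_perm_reading_order] by blast
    have "(tableau_of_word \<alpha> v, tableau_of_word \<alpha> v') \<in> ?E"
      using step.hyps(2) step.IH v' tableau_of_word_std_class[OF assms(1)]
        edge[of "tableau_of_word \<alpha> v" "tableau_of_word \<alpha> v'"]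
        edge[of "tableau_of_word \<alpha> v'" "tableau_of_word \<alpha> v"]
      by auto
    with step.IH v' show ?case by (meson rtrancl.rtrancl_into_rtrancl)
  qed
  have "(T, S) \<in> ?E\<^sup>* \<longleftrightarrow> S \<in> quasi_ribbon_tableaux \<alpha>" for S
  proof
    assume "(T, S) \<in> ?E\<^sup>*"
    then show "S \<in> quasi_ribbon_tableaux \<alpha>"
      by induction (auto simp: assms(2) crystal_edges_def tableau_crystal_sel)
  next
    assume S: "S \<in> quasi_ribbon_tableaux \<alpha>"
    then have "(reading_word T, reading_word S) \<in> ?W\<^sup>*"
      using assms
      by (intro std_class_connected[OF index_perm_reading_order[of \<alpha>]])
        (simp_all add: quasi_ribbon_tableaux_iff)
    moreover have "tableau_of_word \<alpha> (reading_word S) = S"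
      using S tableau_of_word_reading_word[of S] by (simp add: quasi_ribbon_tableaux_def)
    ultimately show "(T, S) \<in> ?E\<^sup>*" using path by metis
  qed
  then show ?thesis
    by (simp add: component_def tableau_crystal_def)
qed

text \<open>Seen on reading words, the map keeps the sorted word and exchanges \<open>q\<close> for
  the reading order, which has the same descents.\<close>

lemma component_word_crystal_iso:
  assumes "composition \<alpha>" "index_perm q" "length q = sum_list \<alpha>" "descent q = same_row \<alpha>"
    and "w \<in> std_class q"
  shows "is_crystal_iso (\<lambda>v. unflatten \<alpha> (map ((!) v) q)) (component word_crystal w) (tableau_crystal \<alpha>)"
proof -
  let ?r = "reading_order \<alpha>"
  define \<psi> where "\<psi> v = unflatten \<alpha> (map ((!) v) q)" for v
  have comp: "component word_crystal w = word_crystal\<lparr>verts := std_class q\<rparr>"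
    using verts_component_word_crystal[OF assms(2,5)] by (simp add: component_def)
  have len: "length v = length q" if "v \<in> std_class q" for v
    using that by (simp add: std_class_def)
  have perm: "index_perm q" "index_perm ?r" "length ?r = length q" "descent ?r = descent q"
    using assms index_perm_reading_order by (simp_all add: descent_reading_order)
  have \<psi>: "shape (\<psi> v) = \<alpha>" "map ((!) v) q = map ((!) (reading_word (\<psi> v))) ?r"
    "length (reading_word (\<psi> v)) = length q" for v
  proof -
    show *: "shape (\<psi> v) = \<alpha>" using assms(3) by (simp add: \<psi>_def shape_unflatten)
    have "concat (\<psi> v) = map ((!) v) q" using assms(3) by (simp add: \<psi>_def concat_unflatten)
    then show "map ((!) v) q = map ((!) (reading_word (\<psi> v))) ?r"
      using * reading_word_reading_order[of "\<psi> v"] by simp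
    show "length (reading_word (\<psi> v)) = length q" using * assms(3) by (simp add: length_reading_word)
  qed
  have \<psi>_verts: "\<psi> v \<in> quasi_ribbon_tableaux \<alpha>" if "v \<in> std_class q" for v
    using sorted_letters_std_class[OF perm \<psi>(3,2) that] \<psi>(1) assms(1)
    by (simp add: quasi_ribbon_tableaux_iff)
  have bij: "bij_betw \<psi> (std_class q) (quasi_ribbon_tableaux \<alpha>)"
    unfolding bij_betw_def
  proof (intro conjI inj_onI subset_antisym subsetI)
    fix v v' assume v: "v \<in> std_class q" "v' \<in> std_class q" "\<psi> v = \<psi> v'"
    then have "map ((!) v) q = map ((!) v') q" using \<psi>(2)[of v] \<psi>(2)[of v'] by simp
    then show "v = v'" by (rule map_nth_inject[OF perm(1) len[OF v(1)] len[OF v(2)]])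
  next
    fix T assume "T \<in> quasi_ribbon_tableaux \<alpha>"
    then have T: "shape T = \<alpha>" "ribbon_sorted (descent q) (concat T)"
      using assms(4) by (auto simp: quasi_ribbon_tableaux_def quasi_ribbon_iff)
    \<comment> \<open>Surjectivity: the entries of \<open>T\<close> are put at the positions named
      by \<open>q\<close>.\<close>
    then obtain v where v: "length v = length q" "map ((!) v) q = concat T"
      using map_nth_surj[OF perm(1), of "concat T"] assms(3) length_concat_shape[of T] by auto
    then have "v \<in> std_class q" using T by (simp add: std_class_iff)
    moreover have "\<psi> v = T" using v T unflatten_concat[of T] by (simp add: \<psi>_def)
    ultimately show "T \<in> \<psi> ` std_class q" by blast
  qed (use \<psi>_verts in auto)
  have crystal: "gl_crystal (word_crystal\<lparr>verts := std_class q\<rparr>)"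
  proof (rule gl_crystal_restrict[OF gl_crystal_word_crystal])
    show "std_class q \<subseteq> verts word_crystal" by (simp add: word_crystal_def)
  next
    fix i v v' assume "v \<in> std_class q" "e_op word_crystal i v = Some v'"
    then show "v' \<in> std_class q"
      using word_e_std_class[OF perm(1), of v i v'] by (simp add: word_crystal_def)
  next
    fix i v v' assume "v \<in> std_class q" "f_op word_crystal i v = Some v'"
    then show "v' \<in> std_class q"
      using word_f_std_class[OF perm(1), of v i v'] by (simp add: word_crystal_def)
  qed
  have "is_crystal_iso \<psi> (word_crystal\<lparr>verts := std_class q\<rparr>) (tableau_crystal \<alpha>)"
    unfolding is_crystal_iso_def
  proof (intro conjI allI ballI)
    show "gl_crystal (word_crystal\<lparr>verts := std_class q\<rparr>)" by (rule crystal)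
    show "gl_crystal (tableau_crystal \<alpha>)" by (rule gl_crystal_tableau_crystal[OF assms(1)])
    show "bij_betw \<psi> (verts (word_crystal\<lparr>verts := std_class q\<rparr>)) (verts (tableau_crystal \<alpha>))"
      using bij by (simp add: tableau_crystal_sel)
  next
    fix i v v'
    assume "v \<in> verts (word_crystal\<lparr>verts := std_class q\<rparr>)"
      "v' \<in> verts (word_crystal\<lparr>verts := std_class q\<rparr>)"
    then have v: "v \<in> std_class q" "v' \<in> std_class q" by simp_all
    have "word_f i v = Some v' \<longleftrightarrow> word_f i (reading_word (\<psi> v)) = Some (reading_word (\<psi> v'))"
      by (rule sorted_letters_word_f_iff[OF perm v(1) \<psi>(3,2) v(2) \<psi>(3,2)])
    then show "f_op (word_crystal\<lparr>verts := std_class q\<rparr>) i v = Some v' \<longleftrightarrow>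
        f_op (tableau_crystal \<alpha>) i (\<psi> v) = Some (\<psi> v')"
      using tableau_crystal_ops(1)[OF assms(1) \<psi>_verts[OF v(1)]] \<psi>_verts[OF v(2)]
      by (simp add: word_crystal_def)
  next
    fix v assume "v \<in> verts (word_crystal\<lparr>verts := std_class q\<rparr>)"
    then have v: "v \<in> std_class q" by simp
    \<comment> \<open>Both words are rearrangements of their common sorted word.\<close>
    have "(\<Sum>a\<leftarrow>reading_word (\<psi> v). basis_weight a) = (\<Sum>a\<leftarrow>v. basis_weight a)"
      using sum_list_index_perm[OF perm(1) len[OF v], of basis_weight]
        sum_list_index_perm[OF perm(2), of "reading_word (\<psi> v)" basis_weight]
        \<psi>(2,3)[of v] perm(3) by simp
    then show "wt (tableau_crystal \<alpha>) (\<psi> v) = wt (word_crystal\<lparr>verts := std_class q\<rparr>) v"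
      by (simp add: tableau_crystal_sel word_crystal_def)
    fix i
    have "word_e i v = None \<longleftrightarrow> word_e i (reading_word (\<psi> v)) = None"
      "word_f i v = None \<longleftrightarrow> word_f i (reading_word (\<psi> v)) = None"
      by (rule sorted_letters_word_e_None_iff[OF perm v \<psi>(3,2)]
          sorted_letters_word_f_None_iff[OF perm v \<psi>(3,2)])+
    then show
      "eps (tableau_crystal \<alpha>) i (\<psi> v) = eps (word_crystal\<lparr>verts := std_class q\<rparr>) i v"
      "phi (tableau_crystal \<alpha>) i (\<psi> v) = phi (word_crystal\<lparr>verts := std_class q\<rparr>) i v"
      unfolding tableau_crystal_sel by (simp_all add: word_crystal_def)
  qed
  then show ?thesis by (simp add: comp \<psi>_def[abs_def])
qed


subsection \<open>Insertion\<close>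

lemma same_row_append:
  "same_row (\<alpha> @ \<beta>) k \<longleftrightarrow> (if k < sum_list \<alpha> then same_row \<alpha> k else same_row \<beta> (k - sum_list \<alpha>))"
  by (induction \<alpha> arbitrary: k) auto

lemma concat_take_nodes: "concat (take_nodes m T) = take m (concat T)"
  by (induction T arbitrary: m) auto

lemma concat_drop_nodes: "concat (drop_nodes m T) = drop m (concat T)"
  by (induction T arbitrary: m) auto

lemma same_row_take_nodes:
  "same_row (shape (take_nodes m T)) k \<longleftrightarrow> Suc k < m \<and> same_row (shape T) k"
  by (induction T arbitrary: m k) (auto simp: shape_def)

lemma same_row_drop_nodes:
  "same_row (shape (drop_nodes m T)) k \<longleftrightarrow> same_row (shape T) (k + m)"
proof (induction T arbitrary: m k)
  case (Cons R T)
  then show ?case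
    using Cons[of "m - length R" k] by (auto simp: shape_def)
qed (simp add: shape_def)

lemma composition_take_nodes:
  "composition (shape T) \<Longrightarrow> composition (shape (take_nodes m T))"
  by (induction T arbitrary: m) (auto simp: composition_def shape_def)

lemma composition_drop_nodes:
  "composition (shape T) \<Longrightarrow> composition (shape (drop_nodes m T))"
  by (induction T arbitrary: m) (auto simp: composition_def shape_def)

section \<open>Gluing at an arbitrary place, in tableaux and in permutations\<close>

definition insert_at :: "nat \<Rightarrow> half \<Rightarrow> tableau \<Rightarrow> tableau" where
  "insert_at m b T = take_nodes m T @
     (case drop_nodes m T of [] \<Rightarrow> [[b]] | R # T' \<Rightarrow> (b # R) # T')"

lemma insert_letter_eq: "insert_letter b T = insert_at (insert_position b T) b T"
  by (simp add: insert_letter_def insert_at_def Let_def)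

lemma concat_insert_at: "concat (insert_at m b T) = take m (concat T) @ b # drop m (concat T)"
  by (simp add: insert_at_def concat_take_nodes flip: concat_drop_nodes split: list.split)

lemma composition_insert_at:
  assumes "composition (shape T)"
  shows "composition (shape (insert_at m b T))"
  using composition_take_nodes[OF assms, of m] composition_drop_nodes[OF assms, of m]
  by (auto simp: insert_at_def composition_def shape_def split: list.split)

text \<open>The new node starts a row and joins the row of its successor, if there is one; the old
  adjacency across the cut disappears. Nodes behind the new one are shifted by one, hence
  \<open>k - 1\<close>.\<close>

lemma same_row_insert_at:
  assumes "composition (shape T)" "m \<le> length (concat T)"
  shows "same_row (shape (insert_at m b T)) k \<longleftrightarrow>
    (if k < m then Suc k < m \<and> same_row (shape T) k
     else if k = m then m < length (concat T) else same_row (shape T) (k - 1))"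
proof -
  define U where "U = (case drop_nodes m T of [] \<Rightarrow> [[b]] | R # T' \<Rightarrow> (b # R) # T')"
  have len: "sum_list (shape (take_nodes m T)) = m"
    using assms(2) by (simp flip: length_concat_shape add: concat_take_nodes)
  have U: "same_row (shape U) l \<longleftrightarrow>
      (if l = 0 then m < length (concat T) else same_row (shape T) (l - 1 + m))" for l
  proof (cases "drop_nodes m T")
    case Nil
    then have "\<not> m < length (concat T)" using concat_drop_nodes[of m T] by simp
    moreover have "\<not> same_row (shape T) (l - 1 + m)"
      using same_row_drop_nodes[of m T "l - 1"] Nil by (simp add: shape_def)
    ultimately show ?thesis using Nil by (cases l) (simp_all add: U_def shape_def)
  next
    case (Cons R T')
    then have "R \<noteq> []"
      using composition_drop_nodes[OF assms(1), of m] by (auto simp: composition_def shape_def)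
    moreover have "m < length (concat T)"
      using concat_drop_nodes[of m T] Cons \<open>R \<noteq> []\<close> by (cases "m < length (concat T)") auto
    moreover have "same_row (shape T) (l - 1 + m) \<longleftrightarrow> same_row (length R # shape T') (l - 1)"
      using same_row_drop_nodes[of m T "l - 1"] Cons by (simp add: shape_def)
    moreover have "shape U = Suc (length R) # shape T'" using Cons by (simp add: U_def shape_def)
    ultimately show ?thesis by (cases l) auto
  qed
  have "shape (insert_at m b T) = shape (take_nodes m T) @ shape U"
    by (simp add: insert_at_def U_def shape_def)
  then show ?thesis
    using len U[of "k - m"] by (auto simp: same_row_append same_row_take_nodes)
qed

text \<open>The index \<open>length q\<close> is the position of a letter appended to the
  word.\<close>

definition insert_index :: "nat \<Rightarrow> nat list \<Rightarrow> nat list" where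
  "insert_index m q = take m q @ length q # drop m q"

lemma length_insert_index [simp]: "length (insert_index m q) = Suc (length q)"
  by (simp add: insert_index_def)

lemma index_perm_insert_index:
  assumes "index_perm q"
  shows "index_perm (insert_index m q)"
proof -
  have "mset (insert_index m q) = mset (length q # take m q @ drop m q)"
    by (simp add: insert_index_def del: append_take_drop_id)
  then have m: "mset (insert_index m q) = mset (length q # q)"
    by (simp only: append_take_drop_id)
  have "distinct (length q # q)" using assms by (auto simp: index_perm_def)
  then have "distinct (insert_index m q)" using m by (metis mset_eq_imp_distinct_iff)
  moreover have "set (insert_index m q) = insert (length q) (set q)"
    using m by (metis mset_eq_setD list.simps(15))
  ultimately show ?thesis using assms by (auto simp: index_perm_def)
qed

text \<open>The new index is the largest, so the step into it is never a descent and the step out of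
  it always is. This is the same case distinction as for rows in
  \<open>same_row_insert_at\<close>.\<close>

lemma descent_insert_index:
  assumes "index_perm q" "m \<le> length q"
  shows "descent (insert_index m q) k \<longleftrightarrow>
    (if k < m then Suc k < m \<and> descent q k else if k = m then m < length q else descent q (k - 1))"
proof -
  have nth: "insert_index m q ! l = (if l < m then q ! l else if l = m then length q else q ! (l - 1))"
    if "l \<le> length q" for l
    using that assms(2) by (auto simp: insert_index_def nth_append nth_Cons' min_def)
  have b: "q ! l < length q" if "l < length q" for l using assms(1) that by (rule index_perm_bound)
  consider "Suc k < m" | "Suc k = m" | "k = m" | "m < k" by linarith
  then show ?thesis
  proof cases
    case 1
    then show ?thesis using assms(2) by (auto simp: descent_def nth)
  next
    case 2
    then show ?thesis using assms(2) b[of k] by (auto simp: descent_def nth)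
  next
    case 3
    then show ?thesis using b[of k] by (auto simp: descent_def nth)
  next
    case 4
    then show ?thesis by (cases k) (auto simp: descent_def nth)
  qed
qed

text \<open>The two insertion inequalities are the tie-breaking rule for the rightmost position: it
  precedes equal integers and follows equal odd letters.\<close>

lemma sorted_wrt_insert_index:
  assumes "index_perm q" "length w = length q" "sorted_wrt (precedes w) q"
    and m: "m = length (takeWhile (\<lambda>t. \<not> (if is_integer b then b \<le> t else b < t)) (map ((!) w) q))"
  shows "sorted_wrt (precedes (w @ [b])) (insert_index m q)"
proof -
  define C where "C t \<longleftrightarrow> (if is_integer b then b \<le> t else b < t)" for t
  have m: "m = length (takeWhile (\<lambda>t. \<not> C t) (map ((!) w) q))" unfolding C_def by (rule m)
  have q: "x < length q" if "x \<in> set q" for x using assms(1) that by (simp add: index_perm_def)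
  have old: "precedes (w @ [b]) x y \<longleftrightarrow> precedes w x y" if "x \<in> set q" "y \<in> set q" for x y
    using q that assms(2) by (simp add: precedes_def nth_append)
  have before: "precedes (w @ [b]) x (length q)" if x: "x \<in> set (take m q)" for x
  proof -
    have "map ((!) w) (take m q) = takeWhile (\<lambda>t. \<not> C t) (map ((!) w) q)"
      by (simp add: m flip: take_map takeWhile_eq_take)
    then have "w ! x \<in> set (takeWhile (\<lambda>t. \<not> C t) (map ((!) w) q))"
      using x by (metis image_eqI set_map)
    then have "\<not> C (w ! x)" by (auto dest: set_takeWhileD)
    then have "ribbon_step False (w ! x) b"
      by (auto simp: C_def ribbon_step_def split: if_splits)
    moreover have "x < length q" using x q in_set_takeD by fast
    ultimately show ?thesis using assms(2) by (simp add: precedes_def nth_append)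
  qed
  have after: "precedes (w @ [b]) (length q) y" if y: "y \<in> set (drop m q)" for y
  proof -
    obtain l where l: "m \<le> l" "l < length q" "y = q ! l"
      using y by (auto simp: in_set_conv_nth) (metis add.commute le_add1 less_diff_conv)
    \<comment> \<open>\<open>takeWhile\<close> yields \<open>C\<close> only at place
      \<open>m\<close>; as \<open>C\<close> is upward closed, it spreads along the weakly increasing
      sorted word.\<close>
    have "C (w ! (q ! m))"
      using nth_length_takeWhile[of "\<lambda>t. \<not> C t" "map ((!) w) q"] l m by simp
    moreover have "w ! (q ! m) \<le> w ! y"
    proof (cases "m = l")
      case False
      then have "precedes w (q ! m) (q ! l)" using l assms(3) by (simp add: sorted_wrt_iff_nth_less)
      then show ?thesis using l by (simp add: precedes_def ribbon_step_def)
    qed (simp add: l)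
    ultimately have "C (w ! y)" by (auto simp: C_def split: if_splits)
    then have "ribbon_step True b (w ! y)"
      by (auto simp: C_def ribbon_step_def split: if_splits)
    moreover have "y < length q" using l assms(1) by (simp add: index_perm_bound)
    ultimately show ?thesis using assms(2) by (simp add: precedes_def nth_append)
  qed
  have split: "sorted_wrt (precedes w) (take m q @ drop m q)" using assms(3) by simp
  have sub: "set (take m q) \<subseteq> set q" "set (drop m q) \<subseteq> set q"
    by (rule set_take_subset set_drop_subset)+
  have mono: "sorted_wrt (precedes (w @ [b])) xs"
    if "sorted_wrt (precedes w) xs" "set xs \<subseteq> set q" for xs
    using that(1) by (rule sorted_wrt_mono_rel[rotated]) (use that(2) old in blast)
  have "sorted_wrt (precedes (w @ [b])) (take m q)" "sorted_wrt (precedes (w @ [b])) (drop m q)"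
    using split sub by (auto simp only: sorted_wrt_append intro: mono)
  moreover have "precedes (w @ [b]) x y" if "x \<in> set (take m q)" "y \<in> set (drop m q)" for x y
    using split that sub old unfolding sorted_wrt_append by blast
  ultimately show ?thesis
    unfolding insert_index_def sorted_wrt_append using before after by auto
qed

text \<open>Permutation and tableau grow in parallel as letters are appended. This is also what
  provides every word with a permutation that sorts it.\<close>

lemma P_tableau_standardisation:
  obtains q where "index_perm q" "w \<in> std_class q" "concat (P_tableau w) = map ((!) w) q"
    "descent q = same_row (shape (P_tableau w))" "composition (shape (P_tableau w))"
proof -
  have "\<exists>q. index_perm q \<and> w \<in> std_class q \<and> concat (P_tableau w) = map ((!) w) q \<and>
    descent q = same_row (shape (P_tableau w)) \<and> composition (shape (P_tableau w))"
  proof (induction w rule: rev_induct)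
    case Nil
    show ?case
      by (rule exI[of _ "[]"])
        (auto simp: index_perm_def std_class_def P_tableau_def descent_def shape_def composition_def)
  next
    case (snoc b w)
    then obtain q where q: "index_perm q" "w \<in> std_class q" "concat (P_tableau w) = map ((!) w) q"
      "descent q = same_row (shape (P_tableau w))" "composition (shape (P_tableau w))"
      by blast
    let ?T = "P_tableau w"
    define m where "m = insert_position b ?T"
    have m: "m = length (takeWhile (\<lambda>t. \<not> (if is_integer b then b \<le> t else b < t)) (map ((!) w) q))"
      by (simp add: m_def insert_position_def q(3))
    have len: "length w = length q" using q(2) by (simp add: std_class_def)
    have P: "P_tableau (w @ [b]) = insert_at m b ?T"
      by (simp add: P_tableau_def insert_letter_eq m_def)
    have mle: "m \<le> length q" using length_takeWhile_le[of _ "map ((!) w) q"] m by simp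
    have "map ((!) (w @ [b])) (insert_index m q) = concat (P_tableau (w @ [b]))"
    proof -
      have "map ((!) (w @ [b])) q = map ((!) w) q"
        using q(1) len by (auto simp: index_perm_def nth_append)
      then have "map ((!) (w @ [b])) (take m q) = take m (map ((!) w) q)"
        "map ((!) (w @ [b])) (drop m q) = drop m (map ((!) w) q)"
        by (metis take_map, metis drop_map)
      then show ?thesis
        unfolding P concat_insert_at q(3) insert_index_def
        by (simp only: map_append list.map nth_append_length[of w b "[]", unfolded len])
    qed
    moreover have "descent (insert_index m q) = same_row (shape (P_tableau (w @ [b])))"
    proof
      fix k
      have "length (concat ?T) = length q" by (simp add: q(3))
      then show "descent (insert_index m q) k = same_row (shape (P_tableau (w @ [b]))) k"
        unfolding P descent_insert_index[OF q(1) mle]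
        using same_row_insert_at[OF q(5), of m b k] mle q(4) by simp
    qed
    moreover have "w @ [b] \<in> std_class (insert_index m q)"
      using sorted_wrt_insert_index[OF q(1) len _ m] q(2) len by (simp add: std_class_def)
    moreover have "composition (shape (P_tableau (w @ [b])))"
      unfolding P by (rule composition_insert_at[OF q(5)])
    ultimately show ?case using index_perm_insert_index[OF q(1), of m] by metis
  qed
  then show thesis using that by blast
qed

theorem corollary3p4:
  shows "(\<forall>w :: word.
            gl_equivalent word_crystal w (tableau_crystal (shape (P_tableau w))) (P_tableau w)) \<and>
         (\<forall>C \<in> components word_crystal.
            \<exists>\<alpha>. composition \<alpha> \<and> crystal_isomorphic C (tableau_crystal \<alpha>))"
proof -
  have main: "composition (shape (P_tableau w)) \<and>
      P_tableau w \<in> quasi_ribbon_tableaux (shape (P_tableau w)) \<and>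
      (\<exists>\<psi>. is_crystal_iso \<psi> (component word_crystal w) (tableau_crystal (shape (P_tableau w))) \<and>
         \<psi> w = P_tableau w)" for w
  proof -
    obtain q where q: "index_perm q" "w \<in> std_class q" "concat (P_tableau w) = map ((!) w) q"
      "descent q = same_row (shape (P_tableau w))" "composition (shape (P_tableau w))"
      by (rule P_tableau_standardisation)
    have len: "length q = sum_list (shape (P_tableau w))"
      using length_concat_shape[of "P_tableau w"] by (simp add: q(3))
    have "ribbon_sorted (same_row (shape (P_tableau w))) (concat (P_tableau w))"
      using q(2) by (simp add: std_class_iff q(3,4))
    then have "P_tableau w \<in> quasi_ribbon_tableaux (shape (P_tableau w))"
      using q(5) by (simp add: quasi_ribbon_tableaux_def quasi_ribbon_iff)
    \<comment> \<open>The value of the isomorphism at \<open>w\<close> itself.\<close>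
    moreover have "unflatten (shape (P_tableau w)) (map ((!) w) q) = P_tableau w"
      using unflatten_concat[of "P_tableau w"] by (simp add: q(3))
    ultimately show ?thesis
      using component_word_crystal_iso[OF q(5,1) len q(4,2)] q(5) by blast
  qed
  have "gl_equivalent word_crystal w (tableau_crystal (shape (P_tableau w))) (P_tableau w)" for w
    unfolding gl_equivalent_def
    using main[of w] gl_crystal_word_crystal gl_crystal_tableau_crystal
      component_tableau_crystal[of "shape (P_tableau w)" "P_tableau w"]
    by (simp add: tableau_crystal_sel word_crystal_def[THEN arg_cong[where f = verts]])
  moreover have "\<exists>\<alpha>. composition \<alpha> \<and> crystal_isomorphic C (tableau_crystal \<alpha>)"
    if "C \<in> components word_crystal" for C
    using that main unfolding components_def crystal_isomorphic_def by blast
  ultimately show ?thesis by blast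
qed

end
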